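(* Let $E$ be a uniformly smooth and uniformly convex real Banach space, let $g:E\to(-\infty,+\infty]$ be an admissible generator, put $U=\operatorname{int}\operatorname{dom} g$, and let $C\subset U$ be nonempty, closed and convex. Let $\{\Theta_l\}_{l\ge1}$ be a countable family of equilibrium bifunctions $C\times C\to\mathbb R$, let $\{A_k\}_{k\ge1}$ be a countable family of norm-continuous monotone mappings $C\to E^*$, and let $\{T_j\}_{j\ge1}$ be a countable family of $J_*$-closed generalized Bregman $J_*$-nonexpansive mappings $C\to E^*$. Assume that for all $l,k\ge1$, all $x\in C$ and all $r>0$ the sets $\mathcal Z_r^{\Theta_l}(x)$ and $\mathcal W_r^{A_k}(x)$ are nonempty. Assume that $$\mathcal S:=\Big(\bigcap_{j\ge1}F_J(T_j)\Big)\cap\Big(\bigcap_{l\ge1}\operatorname{EP}(\Theta_l)\Big)\cap\Big(\bigcap_{k\ge1}\operatorname{VI}(C,A_k)\Big)$$ is nonempty. Let $\alpha_1,\alpha_2,\alpha_3\in(0,1)$ with $\alpha_1+\alpha_2+\alpha_3=1$, let $r_0>0$ and $\{r_n\}\subset[r_0,\infty)$, and let $\tau_T,\tau_A,\tau_\Theta:\mathbb N\to\mathbb N$ be mappings each of which takes every value in $\mathbb N$ infinitely often. Given $x\in C$, put $x_1=x$, $C_1=C$, and for $n\ge1$ $$\begin{cases} z_n=R_{r_n}^{\Theta_{\tau_\Theta(n)}}x_n,\\ u_n=Q_{r_n}^{A_{\tau_A(n)}}x_n,\\ y_n=\nabla g^*\big(\alpha_1\nabla g(x_n)+\alpha_2\nabla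 g(z_n)+\alpha_3\nabla g(J_*T_{\tau_T(n)}u_n)\big),\\ C_{n+1}=\{z\in C_n: D_g(z,y_n)\le D_g(z,x_n)\},\\ x_{n+1}=P^g_{C_{n+1}}x.\end{cases}$$ Then $\{x_n\}$ converges strongly (in norm) to $P^g_{\mathcal S}x$.
   Context: Duality. $E^*$ is the dual of $E$, $\langle\cdot,\cdot\rangle$ the duality pairing, $J:E\to E^*$ the normalized duality mapping, $\langle x,Jx\rangle=\|x\|^2=\|Jx\|^2$. In a uniformly smooth and uniformly convex space $J$ is single-valued and bijective; $J_*:=J^{-1}:E^*\to E$. Generator. $g:E\to(-\infty,+\infty]$ is proper, lower semicontinuous and convex, $g^*$ is its Fenchel conjugate, $U=\operatorname{int}\operatorname{dom}g$, $U^*=\operatorname{int}\operatorname{dom}g^*$. $g$ is Legendre if it is essentially smooth and essentially strictly convex (usual Banach-space sense); then $g$ is differentiable on $U$ and $\nabla g:U\to U^*$ is a bijection with inverse $\nabla g^*$. The Bregman distance is $D_g(x,y)=g(x)-g(y)-\langle\nabla g(y),x-y\rangle$ for $x\in\operatorname{dom}g$, $y\in U$. We call $g$ an admissible generator if: (1) $g$ is Legendre, strongly coercive ($g(x)/\|x\|\to+\infty$ as $\|x\|\to\infty$, $x\in\operatorname{dom}g$), and bounded on bounded subsets of $U$; (2) $g$ is uniformly Fréchet differentiable on bounded subsets of $U$; (3) $g$ is totally convex on bounded subsets of $U$: if $\{x_n\},\{y_n\}$ are bounded sequences in $U$ with $D_g(x_n,y_n)\to0$, then $\|x_n-y_n\|\to0$;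 (4) $g^*$ is uniformly convex on bounded subsets of $U^*$: for each bounded convex $B\subset U^*$ there is a nondecreasing $\rho_B:[0,\infty)\to[0,\infty)$ with $\rho_B(0)=0$, $\rho_B(t)>0$ for $t>0$, and $g^*(\lambda s+(1-\lambda)t)\le\lambda g^*(s)+(1-\lambda)g^*(t)-\lambda(1-\lambda)\rho_B(\|s-t\|)$ for $s,t\in B$, $\lambda\in[0,1]$; (5) for every $x\in U$, $R>0$, the sets $\{z\in U:D_g(z,x)\le R\}$ and $\{z\in U:D_g(x,z)\le R\}$ are bounded and $\nabla g$ maps them into bounded subsets of $E^*$; and $\nabla g^*$ maps bounded subsets of $U^*$ into bounded subsets of $E$ and is uniformly continuous on bounded subsets of $U^*$. Projection. For $D\subset U$ nonempty, closed, convex and $x\in U$, $P^g_Dx$ is the unique minimizer of $z\mapsto D_g(z,x)$ over $D$. Mappings. For $T:C\to E^*$ with $J_*T(C)\subset C$, $F_J(T):=\{p\in C:Tp=Jp\}$. $T$ is generalized Bregman $J_*$-nonexpansive if $J_*T(C)\subset C$, $F_J(T)\ne\emptyset$ and $D_g(p,J_*Tx)\le D_g(p,x)$ for all $x\in C$, $p\in F_J(T)$. $T$ is $J_*$-closed if $J_*T(C)\subset C$ and whenever $x_n\to x$ in $C$ and $J_*Tx_n\to y$ in $E$, then $y=J_*Tx$. Equilibrium problems. A bifunction $\Theta:C\times C\to\mathbb R$ is called an equilibrium bifunction here if $\Theta(x,x)=0$ for all $x$; $\Theta(x,y)+\Theta(y,x)\le0$ for all $x,y$; $\limsup_{t\downarrow0}\Theta(tz+(1-t)x,y)\le\Theta(x,y)$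 for all $x,y,z$; and $\Theta(x,\cdot)$ is convex and lower semicontinuous on $C$ for each $x$. $\operatorname{EP}(\Theta)=\{x^*\in C:\Theta(x^*,y)\ge0\ \forall y\in C\}$. Variational inequalities. $\operatorname{VI}(C,A)=\{x^*\in C:\langle y-x^*,Ax^*\rangle\ge0\ \forall y\in C\}$. Resolvents. For $r>0$, $x\in C$: $\mathcal Z_r^\Theta(x)=\{z\in C:\Theta(z,y)+\frac1r\langle y-z,\nabla g(z)-\nabla g(x)\rangle\ge0\ \forall y\in C\}$, $\mathcal W_r^A(x)=\{z\in C:\langle y-z,Az\rangle+\frac1r\langle y-z,\nabla g(z)-\nabla g(x)\rangle\ge0\ \forall y\in C\}$. For an equilibrium bifunction $\Theta$ and a monotone $A$, when these sets are nonempty they are singletons; their unique elements are denoted $R_r^\Theta x$ and $Q_r^Ax$. *)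

theory Defs
  imports "HOL-Analysis.Analysis"
begin

text \<open>The dual of \<^typ>\<open>'a\<close> is the type \<^typ>\<open>'a \<Rightarrow>\<^sub>L real\<close> of bounded linear functionals with the
  operator norm; the pairing of \<open>x\<close> with \<open>s\<close> is \<open>blinfun_apply s x\<close>, written \<open>s x\<close>.\<close>

type_synonym 'a dual = "'a \<Rightarrow>\<^sub>L real"


subsection \<open>Geometry of the space and duality mapping\<close>

definition uniformly_convex_space :: "'a::real_normed_vector itself \<Rightarrow> bool" where
  "uniformly_convex_space _ \<longleftrightarrow>
     (\<forall>\<epsilon>>0. \<exists>\<delta>>0. \<forall>x y :: 'a. norm x = 1 \<longrightarrow> norm y = 1 \<longrightarrow> norm (x - y) \<ge> \<epsilon> \<longrightarrow>
        norm ((1/2) *\<^sub>R (x + y)) \<le> 1 - \<delta>)"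

text \<open>This says that the modulus of smoothness
  \<open>\<rho>(t) = sup {(\<parallel>x + y\<parallel> + \<parallel>x - y\<parallel>) / 2 - 1 | \<parallel>x\<parallel> = 1, \<parallel>y\<parallel> = t}\<close> is \<open>o(t)\<close> as \<open>t \<down> 0\<close>.\<close>

definition uniformly_smooth_space :: "'a::real_normed_vector itself \<Rightarrow> bool" where
  "uniformly_smooth_space _ \<longleftrightarrow>
     (\<forall>\<epsilon>>0. \<exists>\<delta>>0. \<forall>x y :: 'a. norm x = 1 \<longrightarrow> norm y \<le> \<delta> \<longrightarrow>
        (norm (x + y) + norm (x - y)) / 2 - 1 \<le> \<epsilon> * norm y)"

definition duality_map :: "'a::real_normed_vector \<Rightarrow> 'a dual" where
  "duality_map x = (THE s. blinfun_apply s x = (norm x)\<^sup>2 \<and> (norm s)\<^sup>2 = (norm x)\<^sup>2)"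

definition duality_map_inv :: "'a::real_normed_vector dual \<Rightarrow> 'a" where
  "duality_map_inv = inv duality_map"


subsection \<open>Extended-real-valued convex functions\<close>

definition edom :: "('b \<Rightarrow> ereal) \<Rightarrow> 'b set" where
  "edom f = {x. f x < \<infinity>}"

definition proper_fun :: "('b \<Rightarrow> ereal) \<Rightarrow> bool" where
  "proper_fun f \<longleftrightarrow> (\<forall>x. f x \<noteq> -\<infinity>) \<and> edom f \<noteq> {}"

definition lsc_on :: "'b::topological_space set \<Rightarrow> ('b \<Rightarrow> ereal) \<Rightarrow> bool" where
  "lsc_on S f \<longleftrightarrow> (\<forall>x\<in>S. f x \<le> Liminf (at x within S) f)"

text \<open>Used only for functions that never take the value \<open>-\<infinity>\<close>, so no sum \<open>\<infinity> - \<infinity>\<close> arises.\<close>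

definition convex_fun :: "('b::real_vector \<Rightarrow> ereal) \<Rightarrow> bool" where
  "convex_fun f \<longleftrightarrow>
     (\<forall>x y. \<forall>\<mu>\<in>{0<..<1}.
        f (\<mu> *\<^sub>R x + (1 - \<mu>) *\<^sub>R y) \<le> ereal \<mu> * f x + ereal (1 - \<mu>) * f y)"

definition strictly_convex_fun_on :: "'b::real_vector set \<Rightarrow> ('b \<Rightarrow> ereal) \<Rightarrow> bool" where
  "strictly_convex_fun_on S f \<longleftrightarrow>
     (\<forall>x\<in>S. \<forall>y\<in>S. \<forall>\<mu>\<in>{0<..<1}. x \<noteq> y \<longrightarrow>
        f (\<mu> *\<^sub>R x + (1 - \<mu>) *\<^sub>R y) < ereal \<mu> * f x + ereal (1 - \<mu>) * f y)"

definition fenchel_conjugate :: "('a::real_normed_vector \<Rightarrow> ereal) \<Rightarrow> 'a dual \<Rightarrow> ereal" where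
  "fenchel_conjugate g s = (SUP x. ereal (blinfun_apply s x) - g x)"

definition subdifferential :: "('a::real_normed_vector \<Rightarrow> ereal) \<Rightarrow> 'a \<Rightarrow> 'a dual set" where
  "subdifferential g x =
     {s. x \<in> edom g \<and> (\<forall>y. g x + ereal (blinfun_apply s (y - x)) \<le> g y)}"

definition set_valued_dom :: "('b \<Rightarrow> 'c set) \<Rightarrow> 'b set" where
  "set_valued_dom M = {x. M x \<noteq> {}}"

definition locally_bounded_on_dom ::
    "('b::topological_space \<Rightarrow> 'c::real_normed_vector set) \<Rightarrow> bool" where
  "locally_bounded_on_dom M \<longleftrightarrow>
     (\<forall>x\<in>set_valued_dom M. \<exists>V. open V \<and> x \<in> V \<and> bounded (\<Union>v\<in>V. M v))"

text \<open>Essential smoothness and essential strict convexity in the sense of Bauschke, Borwein and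
  Combettes (2001).\<close>

definition essentially_smooth :: "('a::real_normed_vector \<Rightarrow> ereal) \<Rightarrow> bool" where
  "essentially_smooth g \<longleftrightarrow>
     locally_bounded_on_dom (subdifferential g) \<and>
     (\<forall>x\<in>set_valued_dom (subdifferential g). \<exists>!s. s \<in> subdifferential g x)"

definition essentially_strictly_convex :: "('a::real_normed_vector \<Rightarrow> ereal) \<Rightarrow> bool" where
  "essentially_strictly_convex g \<longleftrightarrow>
     locally_bounded_on_dom (\<lambda>s. {x. s \<in> subdifferential g x}) \<and>
     (\<forall>S. S \<subseteq> set_valued_dom (subdifferential g) \<longrightarrow> convex S \<longrightarrow> strictly_convex_fun_on S g)"

definition legendre :: "('a::real_normed_vector \<Rightarrow> ereal) \<Rightarrow> bool" where
  "legendre g \<longleftrightarrow> essentially_smooth g \<and> essentially_strictly_convex g"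


subsection \<open>Gradients and Bregman distance\<close>

text \<open>Gateaux differentiability with derivative \<open>L\<close>. The difference quotient is taken in
  \<^typ>\<open>ereal\<close>.\<close>

definition has_gateaux_derivative ::
    "('b::real_normed_vector \<Rightarrow> ereal) \<Rightarrow> 'b \<Rightarrow> ('b \<Rightarrow> real) \<Rightarrow> bool" where
  "has_gateaux_derivative f x L \<longleftrightarrow>
     x \<in> interior (edom f) \<and>
     (\<forall>h. ((\<lambda>t. (f (x + t *\<^sub>R h) - f x) / ereal t) \<longlongrightarrow> ereal (L h)) (at 0))"

definition gradient :: "('a::real_normed_vector \<Rightarrow> ereal) \<Rightarrow> 'a \<Rightarrow> 'a dual" where
  "gradient g x = (THE s. has_gateaux_derivative g x (blinfun_apply s))"

text \<open>The gradient of \<open>g\<^sup>*\<close> at \<open>s\<close> belongs to the bidual, which by reflexivity is identified with the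
  space itself: it is the element \<open>x\<close> representing the derivative \<open>t \<mapsto> t x\<close>.\<close>

definition conj_gradient :: "('a::real_normed_vector \<Rightarrow> ereal) \<Rightarrow> 'a dual \<Rightarrow> 'a" where
  "conj_gradient g s =
     (THE x. has_gateaux_derivative (fenchel_conjugate g) s (\<lambda>t. blinfun_apply t x))"

text \<open>Only meaningful, and only used, for \<open>x\<close> in the domain of \<open>g\<close> and \<open>y\<close> in its interior.\<close>

definition bregman :: "('a::real_normed_vector \<Rightarrow> ereal) \<Rightarrow> 'a \<Rightarrow> 'a \<Rightarrow> real" where
  "bregman g x y =
     real_of_ereal (g x) - real_of_ereal (g y) - blinfun_apply (gradient g y) (x - y)"

definition bregman_projection :: "('a::real_normed_vector \<Rightarrow> ereal) \<Rightarrow> 'a set \<Rightarrow> 'a \<Rightarrow> 'a" where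
  "bregman_projection g D x = (THE p. is_arg_min (\<lambda>z. bregman g z x) (\<lambda>z. z \<in> D) p)"


subsection \<open>Admissible generators\<close>

definition strongly_coercive :: "('a::real_normed_vector \<Rightarrow> ereal) \<Rightarrow> bool" where
  "strongly_coercive g \<longleftrightarrow>
     filterlim (\<lambda>x. real_of_ereal (g x) / norm x) at_top (inf at_infinity (principal (edom g)))"

definition bounded_on_bounded :: "('a::real_normed_vector \<Rightarrow> ereal) \<Rightarrow> bool" where
  "bounded_on_bounded g \<longleftrightarrow>
     (\<forall>B. B \<subseteq> interior (edom g) \<longrightarrow> bounded B \<longrightarrow> bounded ((\<lambda>x. real_of_ereal (g x)) ` B))"

text \<open>The limit of the difference quotient is attained uniformly in \<open>x \<in> B\<close> and \<open>\<parallel>h\<parallel> = 1\<close>. As the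
  quotient is extended-real, the inequality includes that \<open>g (x + t h)\<close> is finite.\<close>

definition uniformly_frechet_on_bounded :: "('a::real_normed_vector \<Rightarrow> ereal) \<Rightarrow> bool" where
  "uniformly_frechet_on_bounded g \<longleftrightarrow>
     (\<forall>B. B \<subseteq> interior (edom g) \<longrightarrow> bounded B \<longrightarrow>
        (\<forall>\<epsilon>>0. \<exists>\<delta>>0. \<forall>x\<in>B. \<forall>h. norm h = 1 \<longrightarrow> (\<forall>t. 0 < \<bar>t\<bar> \<and> \<bar>t\<bar> < \<delta> \<longrightarrow>
           \<bar>(g (x + t *\<^sub>R h) - g x) / ereal t - ereal (blinfun_apply (gradient g x) h)\<bar>
             \<le> ereal \<epsilon>)))"

definition totally_convex_on_bounded :: "('a::real_normed_vector \<Rightarrow> ereal) \<Rightarrow> bool" where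
  "totally_convex_on_bounded g \<longleftrightarrow>
     (\<forall>xs ys :: nat \<Rightarrow> 'a.
        range xs \<subseteq> interior (edom g) \<longrightarrow> bounded (range xs) \<longrightarrow>
        range ys \<subseteq> interior (edom g) \<longrightarrow> bounded (range ys) \<longrightarrow>
        (\<lambda>n. bregman g (xs n) (ys n)) \<longlonglongrightarrow> 0 \<longrightarrow> (\<lambda>n. norm (xs n - ys n)) \<longlonglongrightarrow> 0)"

definition conj_uniformly_convex_on_bounded :: "('a::real_normed_vector \<Rightarrow> ereal) \<Rightarrow> bool" where
  "conj_uniformly_convex_on_bounded g \<longleftrightarrow>
     (\<forall>B. B \<subseteq> interior (edom (fenchel_conjugate g)) \<longrightarrow> bounded B \<longrightarrow> convex B \<longrightarrow>
        (\<exists>\<rho> :: real \<Rightarrow> real. mono_on {0..} \<rho> \<and> \<rho> 0 = 0 \<and> (\<forall>t>0. \<rho> t > 0) \<and>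
           (\<forall>s\<in>B. \<forall>t\<in>B. \<forall>\<mu>\<in>{0..1}.
              fenchel_conjugate g (\<mu> *\<^sub>R s + (1 - \<mu>) *\<^sub>R t)
                \<le> ereal \<mu> * fenchel_conjugate g s + ereal (1 - \<mu>) * fenchel_conjugate g t
                   - ereal (\<mu> * (1 - \<mu>) * \<rho> (norm (s - t))))))"

definition bregman_level_bounded :: "('a::real_normed_vector \<Rightarrow> ereal) \<Rightarrow> bool" where
  "bregman_level_bounded g \<longleftrightarrow>
     (\<forall>x\<in>interior (edom g). \<forall>R>0.
        (let L = {z \<in> interior (edom g). bregman g z x \<le> R};
             L' = {z \<in> interior (edom g). bregman g x z \<le> R}
         in bounded L \<and> bounded (gradient g ` L) \<and> bounded L' \<and> bounded (gradient g ` L')))"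

definition conj_gradient_regular :: "('a::real_normed_vector \<Rightarrow> ereal) \<Rightarrow> bool" where
  "conj_gradient_regular g \<longleftrightarrow>
     (\<forall>B. B \<subseteq> interior (edom (fenchel_conjugate g)) \<longrightarrow> bounded B \<longrightarrow>
        bounded (conj_gradient g ` B) \<and> uniformly_continuous_on B (conj_gradient g))"

definition admissible_generator :: "('a::real_normed_vector \<Rightarrow> ereal) \<Rightarrow> bool" where
  "admissible_generator g \<longleftrightarrow>
     proper_fun g \<and> lsc_on UNIV g \<and> convex_fun g \<and>
     legendre g \<and> strongly_coercive g \<and> bounded_on_bounded g \<and>
     uniformly_frechet_on_bounded g \<and>
     totally_convex_on_bounded g \<and>
     conj_uniformly_convex_on_bounded g \<and>
     bregman_level_bounded g \<and> conj_gradient_regular g"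


subsection \<open>Mappings into the dual\<close>

definition FixJ :: "'a::real_normed_vector set \<Rightarrow> ('a \<Rightarrow> 'a dual) \<Rightarrow> 'a set" where
  "FixJ C T = {p \<in> C. T p = duality_map p}"

definition gen_bregman_J_nonexpansive ::
    "('a::real_normed_vector \<Rightarrow> ereal) \<Rightarrow> 'a set \<Rightarrow> ('a \<Rightarrow> 'a dual) \<Rightarrow> bool" where
  "gen_bregman_J_nonexpansive g C T \<longleftrightarrow>
     (\<forall>x\<in>C. duality_map_inv (T x) \<in> C) \<and> FixJ C T \<noteq> {} \<and>
     (\<forall>x\<in>C. \<forall>p\<in>FixJ C T. bregman g p (duality_map_inv (T x)) \<le> bregman g p x)"

definition J_closed :: "'a::real_normed_vector set \<Rightarrow> ('a \<Rightarrow> 'a dual) \<Rightarrow> bool" where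
  "J_closed C T \<longleftrightarrow>
     (\<forall>x\<in>C. duality_map_inv (T x) \<in> C) \<and>
     (\<forall>xs x y. (\<forall>n::nat. xs n \<in> C) \<longrightarrow> x \<in> C \<longrightarrow> xs \<longlonglongrightarrow> x \<longrightarrow>
        (\<lambda>n. duality_map_inv (T (xs n))) \<longlonglongrightarrow> y \<longrightarrow> y = duality_map_inv (T x))"

definition monotone_map_on :: "'a::real_normed_vector set \<Rightarrow> ('a \<Rightarrow> 'a dual) \<Rightarrow> bool" where
  "monotone_map_on C A \<longleftrightarrow> (\<forall>x\<in>C. \<forall>y\<in>C. blinfun_apply (A x - A y) (x - y) \<ge> 0)"


subsection \<open>Equilibrium problems, variational inequalities and resolvents\<close>

definition equilibrium_bifunction ::
    "'a::real_normed_vector set \<Rightarrow> ('a \<Rightarrow> 'a \<Rightarrow> real) \<Rightarrow> bool" where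
  "equilibrium_bifunction C \<Theta> \<longleftrightarrow>
     (\<forall>x\<in>C. \<Theta> x x = 0) \<and>
     (\<forall>x\<in>C. \<forall>y\<in>C. \<Theta> x y + \<Theta> y x \<le> 0) \<and>
     (\<forall>x\<in>C. \<forall>y\<in>C. \<forall>z\<in>C.
        Limsup (at_right 0) (\<lambda>t. ereal (\<Theta> (t *\<^sub>R z + (1 - t) *\<^sub>R x) y)) \<le> ereal (\<Theta> x y)) \<and>
     (\<forall>x\<in>C. convex_on C (\<Theta> x) \<and> lsc_on C (\<lambda>y. ereal (\<Theta> x y)))"

definition EP :: "'a set \<Rightarrow> ('a \<Rightarrow> 'a \<Rightarrow> real) \<Rightarrow> 'a set" where
  "EP C \<Theta> = {p \<in> C. \<forall>y\<in>C. \<Theta> p y \<ge> 0}"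

definition VI :: "'a::real_normed_vector set \<Rightarrow> ('a \<Rightarrow> 'a dual) \<Rightarrow> 'a set" where
  "VI C A = {p \<in> C. \<forall>y\<in>C. blinfun_apply (A p) (y - p) \<ge> 0}"

definition EP_resolvent_set ::
    "('a::real_normed_vector \<Rightarrow> ereal) \<Rightarrow> 'a set \<Rightarrow> ('a \<Rightarrow> 'a \<Rightarrow> real) \<Rightarrow> real \<Rightarrow> 'a \<Rightarrow> 'a set" where
  "EP_resolvent_set g C \<Theta> r x =
     {z \<in> C. \<forall>y\<in>C. \<Theta> z y + (1 / r) * blinfun_apply (gradient g z - gradient g x) (y - z) \<ge> 0}"

definition VI_resolvent_set ::
    "('a::real_normed_vector \<Rightarrow> ereal) \<Rightarrow> 'a set \<Rightarrow> ('a \<Rightarrow> 'a dual) \<Rightarrow> real \<Rightarrow> 'a \<Rightarrow> 'a set" where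
  "VI_resolvent_set g C A r x =
     {z \<in> C. \<forall>y\<in>C. blinfun_apply (A z) (y - z)
        + (1 / r) * blinfun_apply (gradient g z - gradient g x) (y - z) \<ge> 0}"

definition EP_resolvent ::
    "('a::real_normed_vector \<Rightarrow> ereal) \<Rightarrow> 'a set \<Rightarrow> ('a \<Rightarrow> 'a \<Rightarrow> real) \<Rightarrow> real \<Rightarrow> 'a \<Rightarrow> 'a" where
  "EP_resolvent g C \<Theta> r x = the_elem (EP_resolvent_set g C \<Theta> r x)"

definition VI_resolvent ::
    "('a::real_normed_vector \<Rightarrow> ereal) \<Rightarrow> 'a set \<Rightarrow> ('a \<Rightarrow> 'a dual) \<Rightarrow> real \<Rightarrow> 'a \<Rightarrow> 'a" where
  "VI_resolvent g C A r x = the_elem (VI_resolvent_set g C A r x)"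


text \<open>Index maps on the positive integers taking every positive value infinitely often.\<close>

definition index_control :: "(nat \<Rightarrow> nat) \<Rightarrow> bool" where
  "index_control \<tau> \<longleftrightarrow> (\<forall>n\<ge>1. \<tau> n \<ge> 1) \<and> (\<forall>m\<ge>1. infinite {n. n \<ge> 1 \<and> \<tau> n = m})"

end

theory Submission
  imports Defs
begin

text \<open>Uniform differentiability on bounded sets forces \<open>g\<close> to be finite on the whole space. For the
  midpoint \<open>m\<close> of \<open>x\<close> and \<open>y\<close> one has \<open>D x m + D y m = g x + g y - 2 g m\<close>, so total convexity makes
  minimizing sequences of tilts of \<open>g\<close> Cauchy. Hence Bregman projections exist, \<open>\<nabla>g\<close> is onto, and
  the projections onto the shrinking sets \<open>C\<^sub>n\<close> converge to a point \<open>q\<close>. If \<open>\<nabla>g y = \<Sum>\<alpha>\<^sub>i \<nabla>g w\<^sub>i\<close>, then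
  \<open>D p y + \<Sum>\<alpha>\<^sub>i D y w\<^sub>i = \<Sum>\<alpha>\<^sub>i D p w\<^sub>i\<close>; with \<open>p\<close> a common solution this gives \<open>S \<subseteq> C\<^sub>n\<close>, and
  then that \<open>z\<^sub>n\<close>, \<open>u\<^sub>n\<close> and \<open>J\<^sub>* T u\<^sub>n\<close> all converge to \<open>q\<close>. Closedness of the \<open>T\<^sub>j\<close>, surjectivity
  of \<open>J\<close> and Minty's argument put \<open>q\<close> into \<open>S\<close>; the variational inequality of \<open>A\<close> is the
  equilibrium problem of \<open>(x, y) \<mapsto> A x (y - x)\<close>.\<close>

subsection \<open>Surjectivity of the duality mapping\<close>

text \<open>Norm-one vectors on which \<open>s\<close> is almost \<open>norm s\<close> form a Cauchy
  sequence: if two of them stayed apart, uniform convexity would push their midpoint so far into the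
  ball that \<open>s\<close> could not be large there. The limit is then scaled by
  \<open>norm s\<close>.\<close>

lemma norm_attaining:
  fixes s :: "'a::banach dual"
  assumes uc: "uniformly_convex_space TYPE('a)"
  shows "\<exists>x. norm x = norm s \<and> blinfun_apply s x = (norm s)\<^sup>2"
proof (cases "s = 0")
  case True
  then show ?thesis by (intro exI[of _ 0]) auto
next
  case False
  define N where "N = norm s"
  have N: "N > 0" using False by (simp add: N_def)
  have "\<exists>x. norm x = 1 \<and> blinfun_apply s x > N - e" if e: "e > 0" for e
  proof (rule ccontr)
    assume "\<not> ?thesis"
    then have H: "\<And>x. norm x = 1 \<Longrightarrow> blinfun_apply s x \<le> N - e" by force
    \<comment> \<open>A bound for an operator norm must be nonnegative, while \<open>N - e\<close>
      may be negative; hence the \<open>max\<close>.\<close>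
    have le: "norm (blinfun_apply s x) \<le> max 0 (N - e) * norm x" for x
    proof (cases "x = 0")
      case False
      have "blinfun_apply s (y /\<^sub>R norm y) \<le> N - e" if "y \<noteq> 0" for y
        using that by (intro H) auto
      then have ny: "blinfun_apply s y \<le> (N - e) * norm y" if "y \<noteq> 0" for y
        using that by (simp add: blinfun.scaleR_right field_simps)
      have "\<bar>blinfun_apply s x\<bar> \<le> (N - e) * norm x"
        using ny[of x] ny[of "-x"] False by (simp add: blinfun.minus_right abs_le_iff)
      also have "\<dots> \<le> max 0 (N - e) * norm x" by (intro mult_right_mono) auto
      finally show ?thesis by simp
    qed simp
    have "norm s \<le> max 0 (N - e)" by (rule norm_blinfun_bound) (use le in auto)
    then show False using N e unfolding N_def by linarith
  qed
  then have "\<forall>n::nat. \<exists>x. norm x = 1 \<and> blinfun_apply s x > N - 1 / Suc n" by simp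
  then obtain a where a1: "\<And>n. norm (a n) = 1"
    and a2: "\<And>n::nat. blinfun_apply s (a n) > N - 1 / Suc n" by metis
  have "Cauchy a"
  proof (rule metric_CauchyI)
    fix e :: real assume "e > 0"
    then obtain d where d: "d > 0" and
      D: "\<And>x y :: 'a. norm x = 1 \<Longrightarrow> norm y = 1 \<Longrightarrow> norm (x - y) \<ge> e \<Longrightarrow>
        norm ((1/2) *\<^sub>R (x + y)) \<le> 1 - d"
      using uc unfolding uniformly_convex_space_def by meson
    \<comment> \<open>Beyond \<open>M\<close> both values of \<open>s\<close> exceed
      \<open>N - N * d\<close>, hence so does their mean, which for distant vectors is at most
      \<open>N * (1 - d)\<close>.\<close>
    obtain M where M: "1 / real (Suc M) < N * d"
      using reals_Archimedean[of "N * d"] N d by (auto simp: inverse_eq_divide)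
    have "dist (a m) (a n) < e" if "m \<ge> M" "n \<ge> M" for m n
    proof (rule ccontr)
      assume "\<not> ?thesis"
      then have nm: "norm ((1/2) *\<^sub>R (a m + a n)) \<le> 1 - d"
        using a1 by (intro D) (auto simp: dist_norm)
      have "blinfun_apply s ((1/2) *\<^sub>R (a m + a n)) \<le> N * norm ((1/2) *\<^sub>R (a m + a n))"
        using norm_blinfun[of s "(1/2) *\<^sub>R (a m + a n)"] unfolding N_def real_norm_def by linarith
      also have "\<dots> \<le> N * (1 - d)" using N by (intro mult_left_mono nm) simp
      finally have "blinfun_apply s ((1/2) *\<^sub>R (a m + a n)) \<le> N * (1 - d)" .
      then have 1: "(blinfun_apply s (a m) + blinfun_apply s (a n)) / 2 \<le> N - N * d"
        by (simp add: blinfun.scaleR_right blinfun.add_right algebra_simps add_divide_distrib)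
      have "1 / real (Suc m) \<le> 1 / real (Suc M)" "1 / real (Suc n) \<le> 1 / real (Suc M)"
        using that by (auto intro!: divide_left_mono)
      then show False using 1 M a2[of m] a2[of n] by argo
    qed
    then show "\<exists>M. \<forall>m\<ge>M. \<forall>n\<ge>M. dist (a m) (a n) < e" by blast
  qed
  then obtain x where x: "a \<longlonglongrightarrow> x" using Cauchy_convergent convergent_def by blast
  have n1: "norm x = 1"
    using tendsto_norm[OF x] a1 by (simp add: LIMSEQ_const_iff)
  have "(\<lambda>n. N - 1 / real (Suc n)) \<longlonglongrightarrow> N - 0"
    by (intro tendsto_diff tendsto_const LIMSEQ_Suc[OF lim_1_over_n])
  moreover have "(\<lambda>n. blinfun_apply s (a n)) \<longlonglongrightarrow> blinfun_apply s x"
    by (intro blinfun.tendsto tendsto_const x)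
  ultimately have "N - 0 \<le> blinfun_apply s x"
    by (rule LIMSEQ_le) (use a2 in \<open>auto intro: less_imp_le\<close>)
  moreover have "blinfun_apply s x \<le> N" using norm_blinfun[of s x] n1 N_def by auto
  ultimately have "blinfun_apply s x = N" by simp
  then show ?thesis using n1
    by (intro exI[of _ "N *\<^sub>R x"]) (auto simp: blinfun.scaleR_right power2_eq_square N_def)
qed

text \<open>If \<open>s\<close> and \<open>s'\<close> differed at \<open>y\<close>, evaluating
  \<open>s\<close> at \<open>u + t *\<^sub>R y\<close> and \<open>s'\<close> at
  \<open>u - t *\<^sub>R y\<close> would make the sum of the two norms exceed 2 by a fixed multiple
  of \<open>t\<close>, against uniform smoothness.\<close>

lemma duality_functional_unique:
  fixes s s' :: "'a::real_normed_vector dual"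
  assumes us: "uniformly_smooth_space TYPE('a)"
    and "blinfun_apply s x = (norm x)\<^sup>2" "norm s = norm x"
    and "blinfun_apply s' x = (norm x)\<^sup>2" "norm s' = norm x"
  shows "s = s'"
proof (cases "x = 0")
  case True
  then show ?thesis using assms by simp
next
  case False
  define u where "u = x /\<^sub>R norm x"
  have u: "norm u = 1" using False by (simp add: u_def)
  have su: "blinfun_apply s u = norm x" "blinfun_apply s' u = norm x"
    using False assms by (simp_all add: u_def blinfun.scaleR_right power2_eq_square)
  have le: "blinfun_apply s y - blinfun_apply s' y \<le> 0" for y
  proof (rule ccontr)
    assume "\<not> ?thesis"
    then have pos: "blinfun_apply s y - blinfun_apply s' y > 0" by simp
    then have y: "y \<noteq> 0" by auto
    \<comment> \<open>For this \<open>e\<close> the excess over 2 that smoothness allows, multiplied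
      by \<open>norm x\<close>, is exactly half of the linear growth in \<open>t\<close>.\<close>
    define e where "e = (blinfun_apply s y - blinfun_apply s' y) / (4 * norm x * norm y)"
    have e: "e > 0" using pos y False by (simp add: e_def)
    obtain d where d: "d > 0" and
      D: "\<And>x y :: 'a. norm x = 1 \<Longrightarrow> norm y \<le> d \<Longrightarrow>
        (norm (x + y) + norm (x - y)) / 2 - 1 \<le> e * norm y"
      using us e unfolding uniformly_smooth_space_def by meson
    define t where "t = d / norm y"
    have t: "t > 0" using d y by (simp add: t_def)
    have ty: "norm (t *\<^sub>R y) = d" using d y by (simp add: t_def)
    have 1: "norm (u + t *\<^sub>R y) + norm (u - t *\<^sub>R y) \<le> 2 + 2 * e * d"
      using D[OF u eq_refl[OF ty]] unfolding ty by (simp add: field_simps)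
    have "blinfun_apply s (u + t *\<^sub>R y) \<le> norm x * norm (u + t *\<^sub>R y)"
      using norm_blinfun[of s "u + t *\<^sub>R y"] assms by simp
    moreover have "blinfun_apply s' (u - t *\<^sub>R y) \<le> norm x * norm (u - t *\<^sub>R y)"
      using norm_blinfun[of s' "u - t *\<^sub>R y"] assms by simp
    ultimately have "2 * norm x + t * (blinfun_apply s y - blinfun_apply s' y)
        \<le> norm x * (norm (u + t *\<^sub>R y) + norm (u - t *\<^sub>R y))"
      using su by (simp add: blinfun.add_right blinfun.diff_right blinfun.scaleR_right algebra_simps)
    also have "\<dots> \<le> norm x * (2 + 2 * e * d)" using 1 by (intro mult_left_mono) auto
    finally have "t * (blinfun_apply s y - blinfun_apply s' y) \<le> norm x * (2 * e * d)"
      by (simp add: algebra_simps)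
    also have "norm x * (2 * e * d) = t * (blinfun_apply s y - blinfun_apply s' y) / 2"
      using False y by (simp add: e_def t_def field_simps)
    finally show False using mult_pos_pos[OF t pos] by linarith
  qed
  show ?thesis
  proof (rule blinfun_eqI)
    fix y show "blinfun_apply s y = blinfun_apply s' y"
      using le[of y] le[of "-y"] by (simp add: blinfun.minus_right)
  qed
qed

text \<open>Uniform convexity supplies a preimage, uniform smoothness makes the \<open>THE\<close>
  in \<open>duality_map\<close> well defined, and \<open>inv\<close> of a surjection is a right
  inverse.\<close>

lemma duality_map_inv_right:
  fixes s :: "'a::banach dual"
  assumes "uniformly_smooth_space TYPE('a)" "uniformly_convex_space TYPE('a)"
  shows "duality_map (duality_map_inv s) = s"
proof -
  obtain x where x: "norm x = norm s" "blinfun_apply s x = (norm s)\<^sup>2"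
    using norm_attaining[OF assms(2)] by blast
  have "duality_map x = s"
    unfolding duality_map_def
  proof (rule the_equality)
    fix s' assume "blinfun_apply s' x = (norm x)\<^sup>2 \<and> (norm s')\<^sup>2 = (norm x)\<^sup>2"
    then show "s' = s"
      using x by (intro duality_functional_unique[OF assms(1), of _ x]) auto
  qed (use x in auto)
  then show ?thesis unfolding duality_map_inv_def by (metis f_inv_into_f rangeI)
qed

subsection \<open>Totally convex functions\<close>

text \<open>The working interface: what an admissible generator provides once it is known to be
  finite. \<open>G\<close> enters through the subgradient inequality and norm continuity; two
  assumptions spell out the Bregman distance, which is named \<open>D\<close> only
  afterwards.\<close>

locale coercive_totally_convex =
  fixes f :: "'a::banach \<Rightarrow> real" and G :: "'a \<Rightarrow> 'a dual"
  assumes subgradient: "f x + blinfun_apply (G x) (y - x) \<le> f y"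
    and continuous_gradient: "continuous_on UNIV G"
    and totally_convex: "bounded (range a) \<Longrightarrow> bounded (range b) \<Longrightarrow>
      (\<lambda>n::nat. f (a n) - f (b n) - blinfun_apply (G (b n)) (a n - b n)) \<longlonglongrightarrow> 0 \<Longrightarrow>
      (\<lambda>n. a n - b n) \<longlonglongrightarrow> 0"
    and coercive: "\<exists>R. \<forall>x. norm x \<ge> R \<longrightarrow> M * norm x \<le> f x"
    and level_bounded: "bounded {z. f p - f z - blinfun_apply (G z) (p - z) \<le> c}"
begin

section \<open>Bregman distances: identities and continuity\<close>

definition D :: "'a \<Rightarrow> 'a \<Rightarrow> real" where
  "D x y = f x - f y - blinfun_apply (G y) (x - y)"

lemma D_nonneg: "0 \<le> D x y"
  using subgradient[of y x] by (simp add: D_def)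

lemma D_self [simp]: "D x x = 0"
  by (simp add: D_def)

lemma D_three_point:
  "D p x = D p y + D y x + blinfun_apply (G y - G x) (p - y)"
  by (simp add: D_def blinfun.diff_left blinfun.diff_right algebra_simps)

lemma D_symmetric_sum: "D x y + D y x = blinfun_apply (G x - G y) (x - y)"
  using D_three_point[of x x y] D_three_point[of x y x]
  by (simp add: D_def blinfun.diff_left blinfun.diff_right algebra_simps)

lemma D_tendsto_0:
  assumes "bounded (range a)" "bounded (range b)" "(\<lambda>n::nat. D (a n) (b n)) \<longlonglongrightarrow> 0"
  shows "(\<lambda>n. a n - b n) \<longlonglongrightarrow> 0"
  using totally_convex assms unfolding D_def by blast

lemma D_eq_0D: "D x y = 0 \<Longrightarrow> x = y"
  using D_tendsto_0[of "\<lambda>_. x" "\<lambda>_. y"] by (simp add: LIMSEQ_const_iff)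

lemma gradient_monotone_eq:
  assumes "blinfun_apply (G x - G y) (x - y) \<le> 0"
  shows "x = y"
  using D_eq_0D[of x y] D_symmetric_sum[of x y] D_nonneg[of x y] D_nonneg[of y x] assms by linarith

lemma tendsto_gradient: "(a \<longlongrightarrow> x) F \<Longrightarrow> ((\<lambda>n. G (a n)) \<longlongrightarrow> G x) F"
  using continuous_on_tendsto_compose[OF continuous_gradient] by auto

text \<open>A squeeze by tangents: \<open>f (a n)\<close> lies above the tangent at
  \<open>x\<close>, and the tangent at \<open>a n\<close> lies below \<open>f x\<close>, with slopes
  converging by continuity of \<open>G\<close>.\<close>

lemma tendsto_fun:
  assumes "(a \<longlongrightarrow> x) F"
  shows "((\<lambda>n. f (a n)) \<longlongrightarrow> f x) F"
proof (rule tendsto_sandwich)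
  show "((\<lambda>n. f x + blinfun_apply (G x) (a n - x)) \<longlongrightarrow> f x) F"
    by (rule tendsto_eq_intros assms blinfun.tendsto refl)+ (simp add: blinfun.zero_right)
  show "((\<lambda>n. f x - blinfun_apply (G (a n)) (x - a n)) \<longlongrightarrow> f x) F"
    by (rule tendsto_eq_intros assms blinfun.tendsto tendsto_gradient refl)+
       (simp add: blinfun.zero_right)
  show "\<forall>\<^sub>F n in F. f x + blinfun_apply (G x) (a n - x) \<le> f (a n)"
    using subgradient by simp
  show "\<forall>\<^sub>F n in F. f (a n) \<le> f x - blinfun_apply (G (a n)) (x - a n)"
    using subgradient[of "a _" x] by (auto simp: algebra_simps)
qed

lemma tendsto_D:
  assumes "(a \<longlongrightarrow> x) F" "(b \<longlongrightarrow> y) F"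
  shows "((\<lambda>n. D (a n) (b n)) \<longlongrightarrow> D x y) F"
  unfolding D_def by (intro tendsto_intros blinfun.tendsto tendsto_gradient tendsto_fun assms)

section \<open>Midpoint gaps, minimizing sequences and existence of minimizers\<close>

lemma D_midpoint:
  "D x ((1/2) *\<^sub>R (x + y)) + D y ((1/2) *\<^sub>R (x + y)) = f x + f y - 2 * f ((1/2) *\<^sub>R (x + y))"
proof -
  define m where "m = (1/2) *\<^sub>R (x + y)"
  have "(x - m) + (y - m) = 0"
    by (simp add: m_def algebra_simps flip: scaleR_add_left)
  then have "blinfun_apply (G m) (x - m) + blinfun_apply (G m) (y - m) = 0"
    by (simp flip: blinfun.add_right)
  then show ?thesis by (simp add: D_def flip: m_def)
qed

text \<open>By the midpoint identity the gap dominates \<open>D (a n) (m n)\<close>, so total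
  convexity brings \<open>a n\<close> and \<open>m n\<close> together; \<open>a n - b n\<close> is
  twice their difference.\<close>

lemma midpoint_gap_tendsto_0:
  assumes a: "bounded (range a)" and b: "bounded (range b)"
    and gap: "(\<lambda>n::nat. f (a n) + f (b n) - 2 * f ((1/2) *\<^sub>R (a n + b n))) \<longlonglongrightarrow> 0"
  shows "(\<lambda>n. a n - b n) \<longlonglongrightarrow> 0"
proof -
  define m where "m n = (1/2) *\<^sub>R (a n + b n)" for n
  have m: "bounded (range m)"
    unfolding m_def by (rule bounded_scaleR_comp) (rule bounded_plus_comp[OF a b])
  have "(\<lambda>n. D (a n) (m n)) \<longlonglongrightarrow> 0"
  proof (rule tendsto_sandwich[OF _ _ tendsto_const gap])
    show "\<forall>\<^sub>F n in sequentially. D (a n) (m n) \<le> f (a n) + f (b n) - 2 * f ((1/2) *\<^sub>R (a n + b n))"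
      unfolding m_def D_midpoint[symmetric] using D_nonneg by simp
  qed (use D_nonneg in simp)
  then have "(\<lambda>n. a n - m n) \<longlonglongrightarrow> 0" by (rule D_tendsto_0[OF a m])
  then have "(\<lambda>n. 2 *\<^sub>R (a n - m n)) \<longlonglongrightarrow> 2 *\<^sub>R 0" by (intro tendsto_intros)
  then show ?thesis by (simp add: m_def algebra_simps scaleR_2)
qed

text \<open>A linear tilt leaves the midpoint gap unchanged, so the lower bounds \<open>l n\<close>
  force it to vanish. They are the constant infimum when minimizing over one set, and the successive
  minima when the sets shrink.\<close>

lemma minimizing_Cauchy:
  assumes bd: "bounded (range a)"
    and c: "(\<lambda>n::nat. f (a n) - blinfun_apply s (a n)) \<longlonglongrightarrow> L" and l: "l \<longlonglongrightarrow> L"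
    and mid: "\<And>n m. n \<le> m \<Longrightarrow>
      l n \<le> f ((1/2) *\<^sub>R (a n + a m)) - blinfun_apply s ((1/2) *\<^sub>R (a n + a m))"
  shows "Cauchy a"
proof (rule ccontr)
  assume "\<not> Cauchy a"
  \<comment> \<open>Failure of the Cauchy property gives index pairs \<open>p M < q M\<close>,
    ordered as \<open>mid\<close> requires, at distance at least \<open>e\<close>; both indices tend
    to infinity.\<close>
  then obtain e where e: "e > 0" and "\<forall>M. \<exists>m\<ge>M. \<exists>n>m. \<not> dist (a m) (a n) < e"
    unfolding Cauchy_altdef by blast
  then obtain p q where p: "\<And>M. p M \<ge> M" "\<And>M. q M > p M"
    and pq: "\<And>M. \<not> dist (a (p M)) (a (q M)) < e" by metis
  have fp: "filterlim p at_top sequentially" "filterlim q at_top sequentially"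
    by (rule filterlim_at_top_mono[OF filterlim_ident],
        use p in \<open>auto intro!: always_eventually intro: less_imp_le le_less_trans\<close>)+
  have "(\<lambda>n. a (p n) - a (q n)) \<longlonglongrightarrow> 0"
  proof (rule midpoint_gap_tendsto_0)
    show "bounded (range (\<lambda>n. a (p n)))" "bounded (range (\<lambda>n. a (q n)))"
      using bd by (auto intro: bounded_subset)
    have "(\<lambda>n. (f (a (p n)) - blinfun_apply s (a (p n))) + (f (a (q n)) - blinfun_apply s (a (q n)))
        - 2 * l (p n)) \<longlonglongrightarrow> L + L - 2 * L"
      by (intro tendsto_intros filterlim_compose[OF c] filterlim_compose[OF l] fp)
    then have up: "(\<lambda>n. (f (a (p n)) - blinfun_apply s (a (p n)))
        + (f (a (q n)) - blinfun_apply s (a (q n))) - 2 * l (p n)) \<longlonglongrightarrow> 0" by simp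
    show "(\<lambda>n. f (a (p n)) + f (a (q n)) - 2 * f ((1/2) *\<^sub>R (a (p n) + a (q n)))) \<longlonglongrightarrow> 0"
    proof (rule tendsto_sandwich[OF _ _ tendsto_const up])
      show "\<forall>\<^sub>F n in sequentially. 0 \<le> f (a (p n)) + f (a (q n)) - 2 * f ((1/2) *\<^sub>R (a (p n) + a (q n)))"
        unfolding D_midpoint[symmetric] using D_nonneg by simp
      have "f (a (p n)) + f (a (q n)) - 2 * f ((1/2) *\<^sub>R (a (p n) + a (q n)))
          \<le> (f (a (p n)) - blinfun_apply s (a (p n)))
          + (f (a (q n)) - blinfun_apply s (a (q n))) - 2 * l (p n)" for n
        using mid[of "p n" "q n"] p(2)[of n]
        by (simp add: blinfun.scaleR_right blinfun.add_right field_simps)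
      then show "\<forall>\<^sub>F n in sequentially. f (a (p n)) + f (a (q n)) - 2 * f ((1/2) *\<^sub>R (a (p n) + a (q n)))
          \<le> (f (a (p n)) - blinfun_apply s (a (p n)))
          + (f (a (q n)) - blinfun_apply s (a (q n))) - 2 * l (p n)" by simp
    qed
  qed
  then have "\<forall>\<^sub>F n in sequentially. dist (a (p n) - a (q n)) 0 < e"
    using e by (rule tendstoD)
  then show False using pq by (auto simp: dist_norm eventually_sequentially)
qed

lemma tilted_level_bounded:
  assumes "\<And>s. s \<in> B \<Longrightarrow> norm s \<le> M"
  shows "bounded {x. \<exists>s\<in>B. f x - blinfun_apply s x \<le> c}"
proof -
  \<comment> \<open>Slope \<open>M + 1\<close> exceeds every tilt from \<open>B\<close> by at least
    one, so outside radius \<open>R\<close> the tilted value is at least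
    \<open>norm x\<close>.\<close>
  obtain R where R: "\<And>x. norm x \<ge> R \<Longrightarrow> (M + 1) * norm x \<le> f x" using coercive by blast
  have "norm x \<le> max R c" if "s \<in> B" "f x - blinfun_apply s x \<le> c" for x s
  proof (rule ccontr)
    assume "\<not> ?thesis"
    then have n: "norm x > R" "norm x > c" by auto
    have "blinfun_apply s x \<le> norm s * norm x" using norm_blinfun[of s x] by simp
    also have "\<dots> \<le> M * norm x" using assms[OF that(1)] by (intro mult_right_mono) auto
    finally show False using R[of x] n that by (simp add: algebra_simps)
  qed
  then show ?thesis by (auto intro!: boundedI)
qed

text \<open>The direct method in norm: \<open>K\<close> is convex, so midpoints of a minimizing
  sequence stay above the infimum, which makes the sequence Cauchy; its limit lies in the closed set
  \<open>K\<close>.\<close>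

lemma minimizer_exists:
  assumes K: "closed K" "convex K" "K \<noteq> {}"
  obtains x where "x \<in> K"
    "\<And>z. z \<in> K \<Longrightarrow> f x - blinfun_apply s x \<le> f z - blinfun_apply s z"
proof -
  define h where "h x = f x - blinfun_apply s x" for x
  have bdx: "bounded {x. h x \<le> c}" for c
    using tilted_level_bounded[of "{s}" "norm s" c] by (simp add: h_def)
  \<comment> \<open>Points with value at most \<open>h 0\<close> are bounded, and there the
    subgradient at 0 bounds \<open>h\<close> from below; all other values exceed
    \<open>h 0\<close>.\<close>
  have bdd: "bdd_below (range h)"
  proof -
    obtain B where B: "\<And>x. h x \<le> h 0 \<Longrightarrow> norm x \<le> B"
      using bdx[of "h 0"] by (auto simp: bounded_iff)
    have lb: "h x \<ge> f 0 - norm (G 0 - s) * norm x" for x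
      using subgradient[of 0 x] norm_blinfun[of "G 0 - s" x]
      by (simp add: h_def blinfun.diff_left)
    have "h x \<ge> min (h 0) (f 0 - norm (G 0 - s) * B)" for x
    proof (cases "h x \<le> h 0")
      case True
      have "norm (G 0 - s) * norm x \<le> norm (G 0 - s) * B"
        using B[OF True] by (intro mult_left_mono) auto
      then show ?thesis using lb[of x] by linarith
    qed auto
    then show ?thesis by (intro bdd_belowI) blast
  qed
  then have bdd: "bdd_below (h ` K)" by (rule bdd_below_mono) auto
  define L where "L = (INF x\<in>K. h x)"
  have L: "L \<le> h x" if "x \<in> K" for x unfolding L_def using bdd that by (intro cINF_lower) auto
  have "\<exists>x\<in>K. h x < L + 1 / Suc n" for n :: nat
    using cINF_less_iff[of K h "L + 1 / Suc n"] bdd K(3) by (auto simp: L_def)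
  then obtain a where aK: "\<And>n::nat. a n \<in> K" and a: "\<And>n::nat. h (a n) < L + 1 / Suc n" by metis
  have "(\<lambda>n. L + 1 / real (Suc n)) \<longlonglongrightarrow> L + 0"
    by (intro tendsto_intros LIMSEQ_Suc[OF lim_1_over_n])
  then have ha: "(\<lambda>n. h (a n)) \<longlonglongrightarrow> L"
    using a L aK by (intro tendsto_sandwich[of "\<lambda>_. L" "\<lambda>n. h (a n)" _ "\<lambda>n. L + 1 / real (Suc n)"])
      (auto intro!: always_eventually less_imp_le)
  have "Cauchy a"
  proof (rule minimizing_Cauchy)
    have "h (a n) \<le> L + 1" for n using a[of n] by (smt (verit) divide_le_eq_1 of_nat_Suc of_nat_0_le_iff)
    then show "bounded (range a)" using bdx[of "L + 1"] by (auto intro: bounded_subset)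
    show "(\<lambda>n. f (a n) - blinfun_apply s (a n)) \<longlonglongrightarrow> L" using ha by (simp add: h_def)
    show "(\<lambda>_. L) \<longlonglongrightarrow> L" by simp
    fix n m :: nat
    have "(1/2) *\<^sub>R (a n + a m) \<in> K"
      using convexD[OF K(2) aK[of n] aK[of m], of "1/2" "1/2"] by (simp add: scaleR_add_right)
    then show "L \<le> f ((1/2) *\<^sub>R (a n + a m)) - blinfun_apply s ((1/2) *\<^sub>R (a n + a m))"
      using L by (simp add: h_def)
  qed
  then obtain x where x: "a \<longlonglongrightarrow> x" using Cauchy_convergent convergent_def by blast
  have "(\<lambda>n. h (a n)) \<longlonglongrightarrow> h x"
    unfolding h_def by (intro tendsto_intros blinfun.tendsto tendsto_fun x)
  then have "h x = L" using ha LIMSEQ_unique by blast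
  moreover have "x \<in> K" by (rule Lim_in_closed_set[OF K(1) _ _ x]) (use aK in auto)
  ultimately show ?thesis using that L by (simp add: h_def)
qed

section \<open>The gradient as a bijection onto the dual, and its inverse as the conjugate
  gradient\<close>

text \<open>A minimizer \<open>x\<close> of \<open>f\<close> tilted by \<open>s\<close> has gradient
  \<open>s\<close>. Minimality at \<open>x\<close> and the subgradient inequality at
  \<open>x + t *\<^sub>R v\<close> give \<open>s v\<close> at most the gradient there applied to
  \<open>v\<close>; then let \<open>t\<close> decrease to 0.\<close>

lemma gradient_surj: "\<exists>x. G x = s"
proof -
  obtain x where min: "\<And>y. f x - blinfun_apply s x \<le> f y - blinfun_apply s y"
    using minimizer_exists[of UNIV s] by auto
  have le: "blinfun_apply s v \<le> blinfun_apply (G x) v" for v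
  proof (rule tendsto_lowerbound)
    have "((\<lambda>t. x + t *\<^sub>R v) \<longlongrightarrow> x + 0 *\<^sub>R v) (at_right 0)" by (intro tendsto_intros)
    then show "((\<lambda>t. blinfun_apply (G (x + t *\<^sub>R v)) v) \<longlongrightarrow> blinfun_apply (G x) v) (at_right 0)"
      by (intro blinfun.tendsto tendsto_gradient tendsto_const) simp
    have "blinfun_apply s v \<le> blinfun_apply (G (x + t *\<^sub>R v)) v" if "t > 0" for t
    proof -
      have "t * blinfun_apply s v \<le> t * blinfun_apply (G (x + t *\<^sub>R v)) v"
        using min[of "x + t *\<^sub>R v"] subgradient[of "x + t *\<^sub>R v" x]
        by (simp add: blinfun.add_right blinfun.scaleR_right blinfun.minus_right)
      then show ?thesis using that by simp
    qed
    then show "\<forall>\<^sub>F t in at_right 0. blinfun_apply s v \<le> blinfun_apply (G (x + t *\<^sub>R v)) v"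
      by (auto simp: eventually_at_right_less eventually_at_filter)
  qed simp
  have "s = G x"
  proof (rule blinfun_eqI)
    fix v show "blinfun_apply s v = blinfun_apply (G x) v"
      using le[of v] le[of "-v"] by (simp add: blinfun.minus_right)
  qed
  then show ?thesis by blast
qed

lemma gradient_inj: "G x = G y \<Longrightarrow> x = y"
  by (rule gradient_monotone_eq) simp

text \<open>The subgradient inequality tested at 0 puts each \<open>a n\<close> into a tilted level
  set with bounded tilts, so \<open>a\<close> is bounded. Then \<open>D (a n) x\<close> is at most
  the pairing of \<open>G (a n) - G x\<close> with \<open>a n - x\<close>, which vanishes, and total
  convexity concludes.\<close>

lemma tendsto_gradient_inv:
  assumes "(\<lambda>n::nat. G (a n)) \<longlonglongrightarrow> G x"
  shows "a \<longlonglongrightarrow> x"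
proof -
  obtain M where M: "\<And>n. norm (G (a n)) \<le> M"
    using convergent_imp_bounded[OF assms] by (auto simp: bounded_iff)
  have "f (a n) - blinfun_apply (G (a n)) (a n) \<le> f 0" for n
    using subgradient[of "a n" 0] by (simp add: blinfun.minus_right)
  then have bd: "bounded (range a)"
    using M by (intro bounded_subset[OF tilted_level_bounded[of "range (\<lambda>n. G (a n))" M "f 0"]]) auto
  then obtain K where K: "\<And>n. norm (a n - x) \<le> K"
    using bounded_minus_comp[of a UNIV "\<lambda>_. x"] by (auto simp: bounded_iff)
  have up: "(\<lambda>n. norm (G (a n) - G x) * K) \<longlonglongrightarrow> 0"
    using tendsto_mult_right[OF tendsto_norm[OF LIM_zero[OF assms]], of K] by simp
  have "(\<lambda>n. D (a n) x) \<longlonglongrightarrow> 0"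
  proof (rule tendsto_sandwich[OF _ _ tendsto_const up])
    have "D (a n) x \<le> norm (G (a n) - G x) * K" for n
    proof -
      have "D (a n) x \<le> blinfun_apply (G (a n) - G x) (a n - x)"
        using D_symmetric_sum[of "a n" x] D_nonneg[of x "a n"] by simp
      also have "\<dots> \<le> norm (G (a n) - G x) * norm (a n - x)"
        using norm_blinfun[of "G (a n) - G x" "a n - x"] by simp
      also have "\<dots> \<le> norm (G (a n) - G x) * K" using K by (intro mult_left_mono) auto
      finally show ?thesis .
    qed
    then show "\<forall>\<^sub>F n in sequentially. D (a n) x \<le> norm (G (a n) - G x) * K" by simp
  qed (use D_nonneg in simp)
  then have "(\<lambda>n. a n - x) \<longlonglongrightarrow> 0" using D_tendsto_0[OF bd, of "\<lambda>_. x"] by simp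
  then show ?thesis by (rule LIM_zero_cancel)
qed

text \<open>The equality case of the Fenchel-Young inequality: the subgradient inequality says that
  the supremum is attained at \<open>x\<close>.\<close>

lemma fenchel_conjugate_gradient:
  "fenchel_conjugate (\<lambda>x. ereal (f x)) (G x) = ereal (blinfun_apply (G x) x - f x)"
  unfolding fenchel_conjugate_def
proof (rule antisym)
  show "(SUP y. ereal (blinfun_apply (G x) y) - ereal (f y)) \<le> ereal (blinfun_apply (G x) x - f x)"
  proof (rule SUP_least)
    fix y show "ereal (blinfun_apply (G x) y) - ereal (f y) \<le> ereal (blinfun_apply (G x) x - f x)"
      using subgradient[of x y] by (simp add: blinfun.diff_right)
  qed
  show "ereal (blinfun_apply (G x) x - f x) \<le> (SUP y. ereal (blinfun_apply (G x) y) - ereal (f y))"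
    by (rule SUP_upper2[of x]) auto
qed

text \<open>The inverse \<open>\<psi>\<close> of \<open>G\<close> selects a subgradient of the
  conjugate \<open>\<phi>\<close> at each point, and it is continuous by
  \<open>tendsto_gradient_inv\<close>; a continuous selection of subgradients is the
  derivative.\<close>

lemma conj_gradient_gradient: "conj_gradient (\<lambda>x. ereal (f x)) (G x) = x"
proof -
  define \<psi> where "\<psi> s = (SOME x. G x = s)" for s
  have G\<psi>: "G (\<psi> s) = s" for s unfolding \<psi>_def by (rule someI_ex[OF gradient_surj])
  have \<psi>G: "\<psi> (G x) = x" for x using gradient_inj G\<psi> by blast
  define \<phi> where "\<phi> s = blinfun_apply s (\<psi> s) - f (\<psi> s)" for s
  have fc: "fenchel_conjugate (\<lambda>x. ereal (f x)) = (\<lambda>s. ereal (\<phi> s))"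
    using fenchel_conjugate_gradient[of "\<psi> _"] by (auto simp: G\<psi> \<phi>_def)
  have lo: "\<phi> s + blinfun_apply (t - s) (\<psi> s) \<le> \<phi> t" for s t
    using subgradient[of "\<psi> t" "\<psi> s"]
    by (simp add: \<phi>_def G\<psi> blinfun.diff_left blinfun.diff_right)
  define s where "s = G x"
  have lim: "((\<lambda>t. (\<phi> (s + t *\<^sub>R h) - \<phi> s) / t) \<longlongrightarrow> blinfun_apply h (\<psi> s)) (at 0)" for h
  proof -
    have "isCont \<psi> s"
      unfolding continuous_within_sequentially o_def
    proof safe
      fix b :: "nat \<Rightarrow> 'a dual" assume "b \<longlonglongrightarrow> s"
      then show "(\<lambda>n. \<psi> (b n)) \<longlonglongrightarrow> \<psi> s" by (intro tendsto_gradient_inv) (simp add: G\<psi>)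
    qed
    moreover have "((\<lambda>t. s + t *\<^sub>R h) \<longlongrightarrow> s + 0 *\<^sub>R h) (at 0)" by (intro tendsto_intros)
    ultimately have "((\<lambda>t. \<psi> (s + t *\<^sub>R h)) \<longlongrightarrow> \<psi> s) (at 0)"
      by (intro isCont_tendsto_compose[of _ \<psi>]) auto
    then have "((\<lambda>t. norm (blinfun_apply h (\<psi> (s + t *\<^sub>R h) - \<psi> s))) \<longlongrightarrow>
        norm (blinfun_apply h (\<psi> s - \<psi> s))) (at 0)"
      by (intro tendsto_intros blinfun.tendsto)
    then have up: "((\<lambda>t. norm (blinfun_apply h (\<psi> (s + t *\<^sub>R h) - \<psi> s))) \<longlongrightarrow> 0) (at 0)"
      by simp
    have "((\<lambda>t. (\<phi> (s + t *\<^sub>R h) - \<phi> s) / t - blinfun_apply h (\<psi> s)) \<longlongrightarrow> 0) (at 0)"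
    proof (rule Lim_null_comparison[OF _ up])
      have "\<bar>(\<phi> (s + t *\<^sub>R h) - \<phi> s) / t - blinfun_apply h (\<psi> s)\<bar>
          \<le> \<bar>blinfun_apply h (\<psi> (s + t *\<^sub>R h) - \<psi> s)\<bar>" if "t \<noteq> 0" for t
      proof -
        \<comment> \<open>\<open>E\<close> is the first-order remainder; the subgradient
          inequalities at the two ends place it between 0 and \<open>t\<close> times the change of
          \<open>\<psi>\<close> paired with \<open>h\<close>.\<close>
        define E where "E = \<phi> (s + t *\<^sub>R h) - \<phi> s - t * blinfun_apply h (\<psi> s)"
        have E0: "0 \<le> E"
          using lo[of s "s + t *\<^sub>R h"] by (simp add: E_def blinfun.scaleR_left)
        have "E \<le> t * blinfun_apply h (\<psi> (s + t *\<^sub>R h) - \<psi> s)"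
          using lo[of "s + t *\<^sub>R h" s]
          by (simp add: E_def blinfun.scaleR_left blinfun.minus_left blinfun.diff_right algebra_simps)
        then have "\<bar>E\<bar> \<le> \<bar>t\<bar> * \<bar>blinfun_apply h (\<psi> (s + t *\<^sub>R h) - \<psi> s)\<bar>"
          using E0 by (simp add: abs_mult[symmetric])
        then have "\<bar>E / t\<bar> \<le> \<bar>blinfun_apply h (\<psi> (s + t *\<^sub>R h) - \<psi> s)\<bar>"
          using that by (simp add: abs_divide field_simps)
        moreover have "E / t = (\<phi> (s + t *\<^sub>R h) - \<phi> s) / t - blinfun_apply h (\<psi> s)"
          using that by (simp add: E_def field_simps)
        ultimately show ?thesis by simp
      qed
      then show "\<forall>\<^sub>F t in at 0. norm ((\<phi> (s + t *\<^sub>R h) - \<phi> s) / t - blinfun_apply h (\<psi> s))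
          \<le> norm (blinfun_apply h (\<psi> (s + t *\<^sub>R h) - \<psi> s))"
        by (auto simp: eventually_at_filter)
    qed
    then show ?thesis by (rule LIM_zero_cancel)
  qed
  have quot: "((\<lambda>t. (ereal (\<phi> (s + t *\<^sub>R h)) - ereal (\<phi> s)) / ereal t) \<longlongrightarrow> ereal c) (at 0) \<longleftrightarrow>
      ((\<lambda>t. (\<phi> (s + t *\<^sub>R h) - \<phi> s) / t) \<longlongrightarrow> c) (at 0)" for h c
    unfolding lim_ereal[symmetric]
    by (rule tendsto_cong) (auto simp: eventually_at_filter)
  have edom: "edom (\<lambda>s. ereal (\<phi> s)) = UNIV" by (simp add: edom_def)
  have "conj_gradient (\<lambda>x. ereal (f x)) s = \<psi> s"
    unfolding conj_gradient_def fc has_gateaux_derivative_def edom quot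
  proof (rule the_equality)
    fix y assume "s \<in> interior UNIV \<and>
      (\<forall>h. ((\<lambda>t. (\<phi> (s + t *\<^sub>R h) - \<phi> s) / t) \<longlongrightarrow> blinfun_apply h y) (at 0))"
    then have "blinfun_apply h y = blinfun_apply h (\<psi> s)" for h :: "'a dual"
      using tendsto_unique[OF _ _ lim[of h]] by (auto simp: at_neq_bot)
    \<comment> \<open>The test functional is \<open>G y - G (\<psi> s)\<close>, which separates
      distinct points by strict monotonicity of \<open>G\<close>.\<close>
    then show "y = \<psi> s" by (intro gradient_monotone_eq) (simp add: blinfun.diff_right)
  qed (use lim in simp)
  then show ?thesis by (simp add: s_def \<psi>G)
qed

lemma gradient_conj_gradient: "G (conj_gradient (\<lambda>x. ereal (f x)) s) = s"
  using gradient_surj[of s] conj_gradient_gradient by auto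

section \<open>Level sets, Bregman projections and convex combinations of gradients\<close>

lemma D_level_bounded: "bounded {z. D z x \<le> c}"
proof -
  have "{z. D z x \<le> c} \<subseteq> {z. \<exists>s\<in>{G x}. f z - blinfun_apply s z \<le> c + f x - blinfun_apply (G x) x}"
    by (auto simp: D_def blinfun.diff_right)
  then show ?thesis using tilted_level_bounded[of "{G x}" "norm (G x)"] bounded_subset by blast
qed

lemma D_right_level_bounded: "bounded {z. D p z \<le> c}"
  unfolding D_def by (rule level_bounded)

text \<open>The minima \<open>D (a n) x\<close> increase and are bounded by \<open>D w x\<close>,
  hence converge. For later \<open>m\<close> the midpoint of \<open>a n\<close> and
  \<open>a m\<close> still lies in \<open>K n\<close>, so its value is at least the
  \<open>n\<close>-th minimum, as \<open>minimizing_Cauchy\<close> demands; \<open>k\<close> is the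
  constant between \<open>D\<close> and the tilted \<open>f\<close>.\<close>

lemma shrinking_projections:
  assumes K: "\<And>n::nat. closed (K n)" "\<And>n. convex (K n)" "\<And>n. K (Suc n) \<subseteq> K n"
    and a: "\<And>n. a n \<in> K n" "\<And>n z. z \<in> K n \<Longrightarrow> D (a n) x \<le> D z x"
    and w: "\<And>n. w \<in> K n"
  obtains q where "a \<longlonglongrightarrow> q" "\<And>n. q \<in> K n"
    "\<And>z. (\<And>n. z \<in> K n) \<Longrightarrow> D q x \<le> D z x"
proof -
  have mono: "K m \<subseteq> K n" if "n \<le> m" for n m using lift_Suc_antimono_le[of K] K(3) that by blast
  have am: "a m \<in> K n" if "n \<le> m" for n m using mono[OF that] a(1) by blast
  have inc: "incseq (\<lambda>n. D (a n) x)"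
    by (rule incseq_SucI) (use a K(3) in blast)
  have up: "D (a n) x \<le> D w x" for n using a(2) w by blast
  obtain L where L: "(\<lambda>n. D (a n) x) \<longlonglongrightarrow> L" using incseq_convergent[OF inc] up by blast
  define k where "k = f x - blinfun_apply (G x) x"
  have Dk: "f z - blinfun_apply (G x) z = D z x + k" for z
    by (simp add: D_def k_def blinfun.diff_right)
  have "Cauchy a"
  proof (rule minimizing_Cauchy)
    show "bounded (range a)"
      by (rule bounded_subset[OF D_level_bounded[of x "D w x"]]) (use up in auto)
    show "(\<lambda>n. f (a n) - blinfun_apply (G x) (a n)) \<longlonglongrightarrow> L + k"
      unfolding Dk by (intro tendsto_intros L)
    show "(\<lambda>n. D (a n) x + k) \<longlonglongrightarrow> L + k" by (intro tendsto_intros L)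
    fix n m :: nat assume "n \<le> m"
    then have "(1/2) *\<^sub>R (a n + a m) \<in> K n"
      using convexD[OF K(2)[of n] a(1)[of n] am, of m "1/2" "1/2"] by (simp add: scaleR_add_right)
    then show "D (a n) x + k \<le> f ((1/2) *\<^sub>R (a n + a m)) - blinfun_apply (G x) ((1/2) *\<^sub>R (a n + a m))"
      unfolding Dk using a(2) by simp
  qed
  then obtain q where q: "a \<longlonglongrightarrow> q" using Cauchy_convergent convergent_def by blast
  show ?thesis
  proof (rule that[OF q])
    show "q \<in> K n" for n
      by (rule Lim_in_closed_set[OF K(1) _ _ q])
         (use am in \<open>auto simp: eventually_sequentially\<close>)
    show "D q x \<le> D z x" if "\<And>n. z \<in> K n" for z
      by (rule tendsto_upperbound[OF tendsto_D[OF q tendsto_const]]) (use that a(2) in auto)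
  qed
qed

text \<open>The midpoint \<open>m\<close> cannot have a smaller value, so the midpoint identity
  leaves \<open>D p m + D q m \<le> 0\<close>. The point \<open>q\<close> is compared with
  \<open>p\<close> alone, so that \<open>q\<close> may come from a minimization over a smaller
  set.\<close>

lemma projection_unique:
  assumes "convex K" "p \<in> K" "q \<in> K"
    and "\<And>z. z \<in> K \<Longrightarrow> D p x \<le> D z x" and "D q x \<le> D p x"
  shows "q = p"
proof -
  define m where "m = (1/2) *\<^sub>R (p + q)"
  have "m \<in> K" using convexD[OF assms(1-3), of "1/2" "1/2"] by (simp add: m_def scaleR_add_right)
  then have "D p x \<le> D m x" using assms by blast
  moreover have "D p m + D q m = D p x + D q x - 2 * D m x"
    unfolding m_def D_midpoint
    by (simp add: D_def blinfun.diff_right blinfun.scaleR_right blinfun.add_right field_simps)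
  ultimately have "D p m = 0" "D q m = 0"
    using assms(5) D_nonneg[of p m] D_nonneg[of q m] by linarith+
  then show ?thesis using D_eq_0D by metis
qed

lemma projection_exists:
  assumes "closed K" "convex K" "K \<noteq> {}"
  obtains p where "p \<in> K" "\<And>z. z \<in> K \<Longrightarrow> D p x \<le> D z x"
proof -
  obtain p where "p \<in> K" "\<And>z. z \<in> K \<Longrightarrow> f p - blinfun_apply (G x) p \<le> f z - blinfun_apply (G x) z"
    using minimizer_exists[OF assms] by metis
  then show ?thesis by (intro that[of p]) (auto simp: D_def blinfun.diff_right)
qed

text \<open>Apply the three-point identity with \<open>y\<close> in the middle to each base point:
  the weighted gradient differences sum to zero. The remaining terms \<open>D y a\<close>,
  \<open>D y b\<close>, \<open>D y c\<close> are the gaps that later control the iteration.\<close>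

lemma D_convex_combination:
  assumes y: "G y = \<alpha>1 *\<^sub>R G a + \<alpha>2 *\<^sub>R G b + \<alpha>3 *\<^sub>R G c" and \<alpha>: "\<alpha>1 + \<alpha>2 + \<alpha>3 = 1"
  shows "D p y + (\<alpha>1 * D y a + \<alpha>2 * D y b + \<alpha>3 * D y c) = \<alpha>1 * D p a + \<alpha>2 * D p b + \<alpha>3 * D p c"
proof -
  have "\<alpha>1 *\<^sub>R (G y - G a) + \<alpha>2 *\<^sub>R (G y - G b) + \<alpha>3 *\<^sub>R (G y - G c) = (\<alpha>1 + \<alpha>2 + \<alpha>3) *\<^sub>R G y - G y"
    unfolding y by (simp only: algebra_simps)
  then have "blinfun_apply (\<alpha>1 *\<^sub>R (G y - G a) + \<alpha>2 *\<^sub>R (G y - G b) + \<alpha>3 *\<^sub>R (G y - G c)) (p - y) = 0"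
    by (simp add: \<alpha>)
  then have 0: "\<alpha>1 * blinfun_apply (G y - G a) (p - y) + \<alpha>2 * blinfun_apply (G y - G b) (p - y)
      + \<alpha>3 * blinfun_apply (G y - G c) (p - y) = 0"
    by (simp only: blinfun.add_left blinfun.scaleR_left real_scaleR_def)
  have "\<alpha>1 * D p a + \<alpha>2 * D p b + \<alpha>3 * D p c = (\<alpha>1 + \<alpha>2 + \<alpha>3) * D p y
      + (\<alpha>1 * D y a + \<alpha>2 * D y b + \<alpha>3 * D y c)"
    unfolding D_three_point[of p a y] D_three_point[of p b y] D_three_point[of p c y]
    using 0 by (simp only: algebra_simps)
  then show ?thesis using \<alpha> by simp
qed

text \<open>The term \<open>f z\<close> cancels from both sides, leaving an affine inequality in
  \<open>z\<close>.\<close>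

lemma halfspace_D:
  assumes "closed K" "convex K"
  shows "closed {z \<in> K. D z y \<le> D z x}" "convex {z \<in> K. D z y \<le> D z x}"
proof -
  define s where "s = G x - G y"
  define c where "c = f y - blinfun_apply (G y) y - f x + blinfun_apply (G x) x"
  have eq: "{z \<in> K. D z y \<le> D z x} = K \<inter> {z. blinfun_apply s z \<le> c}"
    by (auto simp: D_def s_def c_def blinfun.diff_left blinfun.diff_right)
  have "closed {z. blinfun_apply s z \<le> c}"
    by (intro closed_Collect_le continuous_intros)
  then show "closed {z \<in> K. D z y \<le> D z x}" unfolding eq using assms by blast
  have "convex {z. blinfun_apply s z \<le> c}"
    by (rule convexI) (auto simp: blinfun.add_right blinfun.scaleR_right intro: convex_bound_le)
  then show "convex {z \<in> K. D z y \<le> D z x}" unfolding eq using assms by (intro convex_Int)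
qed

section \<open>Resolvents of equilibrium bifunctions\<close>

text \<open>Test each inequality with the other point and add: monotonicity of
  \<open>\<Theta>\<close> removes the bifunction and leaves the reverse of the monotonicity of
  \<open>G\<close>.\<close>

lemma resolvent_unique:
  assumes \<Theta>: "equilibrium_bifunction C \<Theta>" and r: "r > 0"
    and z: "z \<in> C" "\<And>y. y \<in> C \<Longrightarrow> 0 \<le> \<Theta> z y + (1 / r) * blinfun_apply (G z - G x) (y - z)"
    and z': "z' \<in> C" "\<And>y. y \<in> C \<Longrightarrow> 0 \<le> \<Theta> z' y + (1 / r) * blinfun_apply (G z' - G x) (y - z')"
  shows "z = z'"
proof (rule gradient_monotone_eq)
  have "\<Theta> z z' + \<Theta> z' z \<le> 0" using \<Theta> z z' unfolding equilibrium_bifunction_def by blast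
  then have "0 \<le> (1 / r) * (blinfun_apply (G z - G x) (z' - z) + blinfun_apply (G z' - G x) (z - z'))"
    using z(2)[OF z'(1)] z'(2)[OF z(1)] by (simp only: distrib_left)
  also have "blinfun_apply (G z - G x) (z' - z) + blinfun_apply (G z' - G x) (z - z')
      = - blinfun_apply (G z - G z') (z - z')"
    by (simp add: blinfun.diff_left blinfun.diff_right)
  finally show "blinfun_apply (G z - G z') (z - z') \<le> 0"
    using r by (simp add: zero_le_divide_iff divide_le_0_iff)
qed

text \<open>With \<open>y = p\<close> as test point, \<open>\<Theta> z p \<le> 0\<close> by
  monotonicity, so the pairing in the three-point identity is nonnegative.\<close>

lemma resolvent_D_le:
  assumes \<Theta>: "equilibrium_bifunction C \<Theta>" and r: "r > 0" and p: "p \<in> EP C \<Theta>"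
    and z: "z \<in> C" "\<And>y. y \<in> C \<Longrightarrow> 0 \<le> \<Theta> z y + (1 / r) * blinfun_apply (G z - G x) (y - z)"
  shows "D p z + D z x \<le> D p x"
proof -
  have "\<Theta> z p + \<Theta> p z \<le> 0" "0 \<le> \<Theta> p z"
    using \<Theta> z(1) p unfolding equilibrium_bifunction_def EP_def by blast+
  then have "0 \<le> (1 / r) * blinfun_apply (G z - G x) (p - z)"
    using z(2)[of p] p by (simp add: EP_def)
  then have "0 \<le> blinfun_apply (G z - G x) (p - z)" using r by (simp add: zero_le_divide_iff)
  then show ?thesis using D_three_point[of p x z] by linarith
qed

text \<open>Minty's argument: the limit first yields \<open>\<Theta> y q \<le> 0\<close> for all
  \<open>y\<close>, since the gradient differences vanish and \<open>r0\<close> keeps the factors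
  \<open>1 / r n\<close> bounded; segments towards \<open>y\<close> then turn this into
  \<open>\<Theta> q y \<ge> 0\<close>.\<close>

lemma resolvent_limit_EP:
  assumes \<Theta>: "equilibrium_bifunction C \<Theta>" and C: "convex C"
    and r: "r0 > 0" "\<And>n. r n \<ge> r0"
    and z: "\<And>n::nat. z n \<in> C"
      "\<And>n y. y \<in> C \<Longrightarrow> 0 \<le> \<Theta> (z n) y + (1 / r n) * blinfun_apply (G (z n) - G (x n)) (y - z n)"
    and q: "z \<longlonglongrightarrow> q" "x \<longlonglongrightarrow> q" "q \<in> C"
  shows "q \<in> EP C \<Theta>"
proof -
  have le0: "\<Theta> y q \<le> 0" if y: "y \<in> C" for y
  proof (rule ccontr)
    assume "\<not> ?thesis"
    then obtain c where c: "0 < c" "c < \<Theta> y q" using dense[of 0 "\<Theta> y q"] by auto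
    have "ereal c < Liminf (at q within C) (\<lambda>z. ereal (\<Theta> y z))"
      using \<Theta> y q(3) c(2) unfolding equilibrium_bifunction_def lsc_on_def
      by (meson ereal_less_eq(3) less_le_trans less_ereal.simps(1))
    then have "\<forall>\<^sub>F z in nhds q. z \<noteq> q \<longrightarrow> z \<in> C \<longrightarrow> c < \<Theta> y z"
      using less_LiminfD[of "ereal c" "at q within C" "\<lambda>z. ereal (\<Theta> y z)"]
      unfolding eventually_at_filter by simp
    \<comment> \<open>The \<open>Liminf\<close> ignores the point \<open>q\<close>, which
      \<open>z n\<close> may equal; there the bound is the choice of \<open>c\<close>.\<close>
    then have "\<forall>\<^sub>F z in nhds q. z \<in> C \<longrightarrow> c < \<Theta> y z"
      by (rule eventually_mono) (use c(2) in auto)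
    then have "\<forall>\<^sub>F n in sequentially. c < \<Theta> y (z n)"
      using q(1) z(1) by (auto simp: filterlim_iff)
    moreover have "\<Theta> y (z n) \<le> (1 / r0) * norm (blinfun_apply (G (z n) - G (x n)) (y - z n))" for n
    proof -
      have rn: "r n > 0" using r(1) r(2)[of n] by linarith
      have "\<Theta> (z n) y + \<Theta> y (z n) \<le> 0" using \<Theta> y z(1) unfolding equilibrium_bifunction_def by blast
      then have "\<Theta> y (z n) \<le> (1 / r n) * blinfun_apply (G (z n) - G (x n)) (y - z n)"
        using z(2)[OF y, of n] by linarith
      also have "\<dots> \<le> (1 / r n) * norm (blinfun_apply (G (z n) - G (x n)) (y - z n))"
        using rn by (intro mult_left_mono) auto
      also have "\<dots> \<le> (1 / r0) * norm (blinfun_apply (G (z n) - G (x n)) (y - z n))"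
        using rn r by (intro mult_right_mono divide_left_mono) auto
      finally show ?thesis .
    qed
    ultimately have ev: "\<forall>\<^sub>F n in sequentially.
        c \<le> (1 / r0) * norm (blinfun_apply (G (z n) - G (x n)) (y - z n))"
      by (auto elim!: eventually_mono intro: order_trans less_imp_le)
    have "(\<lambda>n. (1 / r0) * norm (blinfun_apply (G (z n) - G (x n)) (y - z n)))
        \<longlonglongrightarrow> (1 / r0) * norm (blinfun_apply (G q - G q) (y - q))"
      by (intro tendsto_intros blinfun.tendsto tendsto_gradient q)
    then have "c \<le> (1 / r0) * norm (blinfun_apply (G q - G q) (y - q))"
      using tendsto_lowerbound[OF _ ev] by simp
    then show False using c by simp
  qed
  have "0 \<le> \<Theta> q y" if y: "y \<in> C" for y
  proof -
    \<comment> \<open>Convexity in the second argument gives \<open>0 = \<Theta> w w \<le> t *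
      \<Theta> w y + (1 - t) * \<Theta> w q\<close>, whose last term is nonpositive by
      \<open>le0\<close>.\<close>
    have "0 \<le> \<Theta> (t *\<^sub>R y + (1 - t) *\<^sub>R q) y" if t: "0 < t" "t < 1" for t
    proof -
      define w where "w = t *\<^sub>R y + (1 - t) *\<^sub>R q"
      have w: "w \<in> C" unfolding w_def using C y q(3) t by (intro convexD) auto
      have "convex_on C (\<Theta> w)" "\<Theta> w w = 0" using \<Theta> w unfolding equilibrium_bifunction_def by blast+
      then have "0 \<le> t * \<Theta> w y + (1 - t) * \<Theta> w q"
        using convex_onD[of C "\<Theta> w" "1 - t" y q] y q(3) t by (simp add: w_def)
      also have "\<dots> \<le> t * \<Theta> w y" using le0[OF w] t by (simp add: mult_nonneg_nonpos)
      finally show ?thesis using t by (simp add: w_def zero_le_mult_iff)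
    qed
    then have "\<forall>\<^sub>F t in at_right 0. ereal 0 \<le> ereal (\<Theta> (t *\<^sub>R y + (1 - t) *\<^sub>R q) y)"
      by (auto simp: eventually_at_right_field intro!: exI[of _ 1])
    then have "ereal 0 \<le> Limsup (at_right 0) (\<lambda>t. ereal (\<Theta> (t *\<^sub>R y + (1 - t) *\<^sub>R q) y))"
      by (intro le_Limsup) auto
    also have "\<dots> \<le> ereal (\<Theta> q y)"
      using \<Theta> y q(3) unfolding equilibrium_bifunction_def by blast
    finally show ?thesis by simp
  qed
  then show ?thesis using q(3) by (simp add: EP_def)
qed

end

subsection \<open>Variational inequalities as equilibrium problems\<close>

text \<open>Monotonicity of \<open>A\<close> is the sign condition on the symmetric sum, norm
  continuity gives the limsup condition along segments, and the dependence on \<open>y\<close> is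
  affine.\<close>

lemma equilibrium_bifunction_monotone_map:
  assumes C: "convex C" and A: "continuous_on C A" "monotone_map_on C A"
  shows "equilibrium_bifunction C (\<lambda>x y. blinfun_apply (A x) (y - x))"
  unfolding equilibrium_bifunction_def
proof (intro conjI ballI)
  fix x y assume x: "x \<in> C" and y: "y \<in> C"
  have "0 \<le> blinfun_apply (A x - A y) (x - y)"
    using A(2) x y unfolding monotone_map_on_def by blast
  then show "blinfun_apply (A x) (y - x) + blinfun_apply (A y) (x - y) \<le> 0"
    by (simp add: blinfun.diff_left blinfun.diff_right)
  fix z assume z: "z \<in> C"
  have "((\<lambda>t. t *\<^sub>R z + (1 - t) *\<^sub>R x) \<longlongrightarrow> 0 *\<^sub>R z + (1 - 0) *\<^sub>R x) (at_right 0)"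
    by (intro tendsto_intros)
  then have lim: "((\<lambda>t. t *\<^sub>R z + (1 - t) *\<^sub>R x) \<longlongrightarrow> x) (at_right 0)" by simp
  have "t *\<^sub>R z + (1 - t) *\<^sub>R x \<in> C" if "0 < t" "t < 1" for t
    using C x z that by (intro convexD) auto
  then have "\<forall>\<^sub>F t in at_right 0. t *\<^sub>R z + (1 - t) *\<^sub>R x \<in> C"
    by (auto simp: eventually_at_right_field intro!: exI[of _ 1])
  then have L: "((\<lambda>t. ereal (blinfun_apply (A (t *\<^sub>R z + (1 - t) *\<^sub>R x)) (y - (t *\<^sub>R z + (1 - t) *\<^sub>R x))))
      \<longlongrightarrow> ereal (blinfun_apply (A x) (y - x))) (at_right 0)"
    unfolding lim_ereal
    by (intro blinfun.tendsto tendsto_intros continuous_on_tendsto_compose[OF A(1)] lim x)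
  then show "Limsup (at_right 0) (\<lambda>t. ereal (blinfun_apply (A (t *\<^sub>R z + (1 - t) *\<^sub>R x))
      (y - (t *\<^sub>R z + (1 - t) *\<^sub>R x)))) \<le> ereal (blinfun_apply (A x) (y - x))"
    by (intro eq_refl lim_imp_Limsup[OF _ L]) simp
next
  fix x assume "x \<in> C"
  show "convex_on C (\<lambda>y. blinfun_apply (A x) (y - x))"
    by (rule convex_onI[OF _ C])
       (simp add: blinfun.add_right blinfun.diff_right blinfun.scaleR_right algebra_simps)
  show "lsc_on C (\<lambda>y. ereal (blinfun_apply (A x) (y - x)))"
    unfolding lsc_on_def
  proof
    fix y assume "y \<in> C"
    have L: "((\<lambda>y. ereal (blinfun_apply (A x) (y - x))) \<longlongrightarrow> ereal (blinfun_apply (A x) (y - x))) (at y within C)"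
      unfolding lim_ereal by (intro blinfun.tendsto tendsto_intros)
    show "ereal (blinfun_apply (A x) (y - x)) \<le> Liminf (at y within C) (\<lambda>y. ereal (blinfun_apply (A x) (y - x)))"
      \<comment> \<open>At an isolated point the filter is trivial and its \<open>Liminf\<close> is
        the top element.\<close>
      by (cases "at y within C = bot") (use lim_imp_Liminf[OF _ L] in auto)
  qed
qed (simp add: blinfun.zero_right)

lemma VI_eq_EP: "VI C A = EP C (\<lambda>x y. blinfun_apply (A x) (y - x))"
  by (simp add: VI_def EP_def)

lemma VI_resolvent_set_eq_EP:
  "VI_resolvent_set g C A = EP_resolvent_set g C (\<lambda>x y. blinfun_apply (A x) (y - x))"
  by (simp add: VI_resolvent_set_def EP_resolvent_set_def fun_eq_iff)

subsection \<open>Admissible generators\<close>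

text \<open>Uniform differentiability on a bounded set gives a uniform distance to the complement of the
  domain, so the interior of the domain is closed.\<close>

lemma uniformly_frechet_edom:
  fixes g :: "'a::real_normed_vector \<Rightarrow> ereal"
  assumes uf: "uniformly_frechet_on_bounded g" and ne: "interior (edom g) \<noteq> {}"
    and ninf: "\<And>x. g x \<noteq> -\<infinity>"
  shows "edom g = UNIV"
proof -
  have "closed (interior (edom g))"
    unfolding closed_limpt
  proof safe
    fix p assume p: "p islimpt interior (edom g)"
    \<comment> \<open>The ball makes \<open>B\<close> bounded, so one \<open>d\<close> serves all
      its points; one of them is closer to \<open>p\<close> than \<open>d\<close>.\<close>
    define B where "B = interior (edom g) \<inter> ball p 1"
    have "B \<subseteq> interior (edom g)" "bounded B" by (auto simp: B_def intro: bounded_subset[OF bounded_ball])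
    then obtain d where d: "d > 0" and H: "\<And>x h t. x \<in> B \<Longrightarrow> norm h = 1 \<Longrightarrow> 0 < \<bar>t\<bar> \<Longrightarrow> \<bar>t\<bar> < d \<Longrightarrow>
        \<bar>(g (x + t *\<^sub>R h) - g x) / ereal t - ereal (blinfun_apply (gradient g x) h)\<bar> \<le> ereal 1"
      using uf zero_less_one unfolding uniformly_frechet_on_bounded_def by meson
    obtain x where x: "x \<in> interior (edom g)" "dist x p < min 1 d"
      using p d unfolding islimpt_approachable by (metis min_less_iff_conj zero_less_one)
    then have xB: "x \<in> B" by (auto simp: B_def dist_commute)
    have xe: "x \<in> edom g" using x(1) interior_subset by blast
    have "ball x d \<subseteq> edom g"
    proof
      fix y assume y: "y \<in> ball x d"
      show "y \<in> edom g"
      proof (cases "y = x")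
        case False
        define t where "t = norm (y - x)"
        define h where "h = (y - x) /\<^sub>R t"
        have t: "0 < t" "t < d" using y False by (auto simp: t_def dist_norm norm_minus_commute)
        have yx: "x + t *\<^sub>R h = y" using t by (simp add: h_def)
        have "norm h = 1" using t by (simp add: h_def t_def)
        then have "\<bar>(g y - g x) / ereal t - ereal (blinfun_apply (gradient g x) h)\<bar> \<le> ereal 1"
          using H[OF xB, of h t] t yx by simp
        \<comment> \<open>An infinite \<open>g y\<close> would make the quotient infinite, against
          the finite bound.\<close>
        then show ?thesis using xe t ninf[of x] unfolding edom_def
          by (cases "g y"; cases "g x") auto
      qed (use xe in simp)
    qed
    then have "ball x d \<subseteq> interior (edom g)" by (intro interior_maximal) auto
    then show "p \<in> interior (edom g)" using x(2) by auto
  qed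
  then have "interior (edom g) = UNIV" using clopen ne by blast
  then show ?thesis using interior_subset by blast
qed

lemma uniformly_frechet_gradient_ineq:
  fixes f :: "'a::real_normed_vector \<Rightarrow> real"
  assumes uf: "uniformly_frechet_on_bounded (\<lambda>x. ereal (f x))" and B: "bounded B" and e: "e > 0"
  obtains d where "d > 0" "\<And>x v. x \<in> B \<Longrightarrow> norm v < d \<Longrightarrow>
    \<bar>f (x + v) - f x - blinfun_apply (gradient (\<lambda>x. ereal (f x)) x) v\<bar> \<le> e * norm v"
proof -
  define G where "G = gradient (\<lambda>x. ereal (f x))"
  have "B \<subseteq> interior (edom (\<lambda>x. ereal (f x)))" by (simp add: edom_def)
  then obtain d where d: "d > 0" and H: "\<And>x h t. x \<in> B \<Longrightarrow> norm h = 1 \<Longrightarrow> 0 < \<bar>t\<bar> \<Longrightarrow> \<bar>t\<bar> < d \<Longrightarrow>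
      \<bar>(ereal (f (x + t *\<^sub>R h)) - ereal (f x)) / ereal t - ereal (blinfun_apply (G x) h)\<bar> \<le> ereal e"
    using uf B e unfolding uniformly_frechet_on_bounded_def G_def by meson
  have "\<bar>f (x + v) - f x - blinfun_apply (G x) v\<bar> \<le> e * norm v" if "x \<in> B" "norm v < d" for x v
  proof (cases "v = 0")
    case False
    define t where "t = norm v"
    define h where "h = v /\<^sub>R t"
    have t: "0 < t" "t < d" using False that by (auto simp: t_def)
    have v: "t *\<^sub>R h = v" "norm h = 1" using t by (simp_all add: h_def t_def)
    have "\<bar>(f (x + v) - f x) / t - blinfun_apply (G x) h\<bar> \<le> e"
      using H[OF that(1) v(2), of t] t v(1) by simp
    then have "t * \<bar>(f (x + v) - f x) / t - blinfun_apply (G x) h\<bar> \<le> t * e" using t by simp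
    also have "t * \<bar>(f (x + v) - f x) / t - blinfun_apply (G x) h\<bar>
        = \<bar>t * ((f (x + v) - f x) / t - blinfun_apply (G x) h)\<bar>" using t by (simp add: abs_mult)
    also have "t * ((f (x + v) - f x) / t - blinfun_apply (G x) h) = f (x + v) - f x - blinfun_apply (G x) v"
      using t arg_cong[OF v(1), of "blinfun_apply (G x)"]
      by (simp only: right_diff_distrib blinfun.scaleR_right real_scaleR_def) simp
    finally show ?thesis by (simp add: t_def mult.commute)
  qed (simp add: blinfun.zero_right)
  then show ?thesis using that d unfolding G_def by blast
qed

text \<open>The passage from extended-real generators to the locale. Uniform differentiability and
  convexity make the gradient a norm-continuous selection of subgradients; the other locale
  assumptions are direct translations.\<close>

lemma admissible_generator_real:
  fixes g :: "'a::banach \<Rightarrow> ereal"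
  assumes ag: "admissible_generator g" and ne: "interior (edom g) \<noteq> {}"
  obtains f where "g = (\<lambda>x. ereal (f x))" "coercive_totally_convex f (gradient g)"
proof -
  define f where "f x = real_of_ereal (g x)" for x
  have ninf: "g x \<noteq> -\<infinity>" for x
    using ag by (auto simp: admissible_generator_def proper_fun_def)
  have uf: "uniformly_frechet_on_bounded g" using ag by (simp add: admissible_generator_def)
  have edom: "edom g = UNIV" by (rule uniformly_frechet_edom[OF uf ne ninf])
  then have "g x < \<infinity>" for x by (auto simp: edom_def)
  then have gf: "g x = ereal (f x)" for x using ninf[of x] by (cases "g x") (auto simp: f_def less_le)
  then have g: "g = (\<lambda>x. ereal (f x))" by auto
  define G where "G = gradient g"
  have br: "bregman g x y = f x - f y - blinfun_apply (G y) (x - y)" for x y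
    by (simp add: bregman_def f_def G_def)
  have diff: "\<exists>d>0. \<forall>x\<in>B. \<forall>v. norm v < d \<longrightarrow> \<bar>f (x + v) - f x - blinfun_apply (G x) v\<bar> \<le> e * norm v"
    if "bounded B" "e > 0" for B e
    using uniformly_frechet_gradient_ineq[OF uf[unfolded g] that] unfolding G_def g by metis
  have cvx: "f (\<mu> *\<^sub>R x + (1 - \<mu>) *\<^sub>R y) \<le> \<mu> * f x + (1 - \<mu>) * f y" if "0 < \<mu>" "\<mu> < 1" for x y \<mu>
  proof -
    have "convex_fun g" using ag by (simp add: admissible_generator_def)
    then show ?thesis using that unfolding convex_fun_def g by auto
  qed
  \<comment> \<open>The expansion at \<open>x\<close> along the segment to \<open>y\<close> errs by
    at most \<open>t * e\<close>, and convexity bounds the same value by the chord; division by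
    \<open>t\<close> leaves only the error \<open>e\<close>.\<close>
  have sub: "f x + blinfun_apply (G x) (y - x) \<le> f y" for x y
  proof (cases "y = x")
    case False
    define n where "n = norm (y - x)"
    have n: "n > 0" using False by (simp add: n_def)
    show ?thesis
    proof (rule field_le_epsilon)
      fix e :: real assume e: "e > 0"
      then obtain d where d: "d > 0" and H: "\<And>v. norm v < d \<Longrightarrow>
          \<bar>f (x + v) - f x - blinfun_apply (G x) v\<bar> \<le> e / n * norm v"
        using diff[of "{x}" "e / n"] n by auto
      \<comment> \<open>The first bound keeps \<open>t\<close> a convex weight, the second keeps the
        step within the radius \<open>d\<close>.\<close>
      define t where "t = min (1/2) (d / (2 * n))"
      have t: "0 < t" "t < 1" using d n by (auto simp: t_def)
      have "t * n \<le> d / (2 * n) * n" using n by (intro mult_right_mono) (auto simp: t_def)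
      also have "\<dots> < d" using n d by simp
      finally have "norm (t *\<^sub>R (y - x)) < d" using t by (simp add: n_def)
      then have "\<bar>f (x + t *\<^sub>R (y - x)) - f x - blinfun_apply (G x) (t *\<^sub>R (y - x))\<bar>
          \<le> e / n * norm (t *\<^sub>R (y - x))" by (rule H)
      also have "\<dots> = t * e" using n t by (simp add: n_def)
      finally have "f x + t * blinfun_apply (G x) (y - x) - t * e \<le> f (x + t *\<^sub>R (y - x))"
        by (simp add: blinfun.scaleR_right abs_le_iff)
      also have "x + t *\<^sub>R (y - x) = t *\<^sub>R y + (1 - t) *\<^sub>R x" by (simp add: algebra_simps)
      also have "f \<dots> \<le> t * f y + (1 - t) * f x" by (rule cvx[OF t])
      finally have "t * (f x + blinfun_apply (G x) (y - x)) \<le> t * (f y + e)"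
        by (simp add: algebra_simps)
      then show "f x + blinfun_apply (G x) (y - x) \<le> f y + e" using t by simp
    qed
  qed (simp add: blinfun.zero_right)
  have "coercive_totally_convex f G"
  proof
    show "f x + blinfun_apply (G x) (y - x) \<le> f y" for x y by (rule sub)
    show "continuous_on UNIV G"
      unfolding continuous_on_iff
    proof safe
      fix x and e :: real assume e: "e > 0"
      obtain d where d: "d > 0" and H: "\<And>y v. y \<in> ball x 1 \<Longrightarrow> norm v < d \<Longrightarrow>
          \<bar>f (y + v) - f y - blinfun_apply (G y) v\<bar> \<le> e / 4 * norm v"
        using diff[of "ball x 1" "e / 4"] e by auto
      \<comment> \<open>The gradients are compared on a vector \<open>h\<close> of length
        \<open>t\<close>, using the subgradient inequality at \<open>y\<close> and the expansion at
        \<open>x\<close>. Since \<open>y - x + h\<close> has norm at most \<open>2 * t < d\<close>,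
        the expansion applies, and its error divided by \<open>t\<close> is at most
        \<open>e / 2\<close>.\<close>
      define t where "t = d / 4"
      have t: "t > 0" using d by (simp add: t_def)
      have "dist (G y) (G x) < e" if "dist y x < min 1 t" for y
      proof -
        have yx: "norm (y - x) < t" using that by (simp add: dist_norm)
        have le: "blinfun_apply (G y - G x) v \<le> e / 2 * norm v" if v: "v \<noteq> 0" for v
        proof -
          define h where "h = (t / norm v) *\<^sub>R v"
          have h: "norm h = t" using v t by (simp add: h_def)
          have n2: "norm (y - x + h) \<le> 2 * t"
            using norm_triangle_ineq[of "y - x" h] h yx by simp
          have "blinfun_apply (G y) h \<le> f (y + h) - f y" using sub[of y "y + h"] by simp
          also have "\<dots> \<le> f (y + h) - f x - blinfun_apply (G x) (y - x)" using sub[of x y] by simp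
          also have "f (y + h) = f (x + (y - x + h))" by simp
          also have "\<dots> \<le> f x + blinfun_apply (G x) (y - x + h) + e / 4 * norm (y - x + h)"
            using H[of x "y - x + h"] n2 d unfolding t_def abs_le_iff by simp
          also have "\<dots> \<le> f x + blinfun_apply (G x) (y - x + h) + e / 4 * (2 * t)"
            using mult_left_mono[OF n2, of "e / 4"] e by simp
          finally have "blinfun_apply (G y - G x) h \<le> e / 2 * t"
            by (simp add: blinfun.diff_left blinfun.add_right)
          then have "t * (blinfun_apply (G y - G x) v / norm v) \<le> t * (e / 2)"
            by (simp add: h_def blinfun.scaleR_right mult.commute)
          then have "blinfun_apply (G y - G x) v / norm v \<le> e / 2"
            by (rule mult_left_le_imp_le[OF _ t])
          then show ?thesis using v by (simp add: divide_le_eq)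
        qed
        have "norm (blinfun_apply (G y - G x) v) \<le> e / 2 * norm v" for v
          using le[of v] le[of "-v"] by (cases "v = 0") (auto simp: blinfun.minus_right abs_le_iff)
        then have "norm (G y - G x) \<le> e / 2" using e by (intro norm_blinfun_bound) auto
        then show ?thesis using e by (simp add: dist_norm)
      qed
      then show "\<exists>d>0. \<forall>x'\<in>UNIV. dist x' x < d \<longrightarrow> dist (G x') (G x) < e"
        using t by (intro exI[of _ "min 1 t"]) auto
    qed
    show "(\<lambda>n. a n - b n) \<longlonglongrightarrow> 0" if "bounded (range a)" "bounded (range b)"
      "(\<lambda>n::nat. f (a n) - f (b n) - blinfun_apply (G (b n)) (a n - b n)) \<longlonglongrightarrow> 0" for a b
    proof -
      have "totally_convex_on_bounded g" using ag by (simp add: admissible_generator_def)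
      then show ?thesis using that
        unfolding totally_convex_on_bounded_def edom br tendsto_norm_zero_iff by auto
    qed
    show "\<exists>R. \<forall>x. norm x \<ge> R \<longrightarrow> M * norm x \<le> f x" for M
    proof -
      have "filterlim (\<lambda>x. f x / norm x) at_top at_infinity"
        using ag unfolding admissible_generator_def strongly_coercive_def edom by (simp add: f_def)
      then have "\<forall>\<^sub>F x in at_infinity. M \<le> f x / norm x" by (simp add: filterlim_at_top)
      then obtain b where b: "\<And>x. norm x \<ge> b \<Longrightarrow> M \<le> f x / norm x"
        by (auto simp: eventually_at_infinity)
      have "M * norm x \<le> f x" if x: "norm x \<ge> max b 1" for x
      proof -
        have "norm x > 0" using x by auto
        then show ?thesis using b[of x] x by (simp add: pos_le_divide_eq)
      qed
      then show ?thesis by blast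
    qed
    show "bounded {z. f p - f z - blinfun_apply (G z) (p - z) \<le> c}" for p c
    proof -
      have "bregman_level_bounded g" using ag by (simp add: admissible_generator_def)
      \<comment> \<open>Level sets are known to be bounded for positive levels only; hence the
        \<open>max\<close>.\<close>
      moreover have "max c 1 > 0" by simp
      ultimately have "bounded {z. bregman g p z \<le> max c 1}"
        by (simp add: bregman_level_bounded_def edom Let_def)
      then show ?thesis by (rule bounded_subset) (auto simp: br)
    qed
  qed
  then show ?thesis using that g G_def by blast
qed

subsection \<open>Strong convergence\<close>

theorem theorem3p2:
  fixes g :: "'a::banach \<Rightarrow> ereal"
    and C S :: "'a set"
    and \<Theta> :: "nat \<Rightarrow> 'a \<Rightarrow> 'a \<Rightarrow> real"
    and A T :: "nat \<Rightarrow> 'a \<Rightarrow> 'a dual"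
    and \<alpha>1 \<alpha>2 \<alpha>3 r0 :: real
    and r :: "nat \<Rightarrow> real"
    and \<tau>T \<tau>A \<tau>\<Theta> :: "nat \<Rightarrow> nat"
    and x :: 'a
    and xs ys zs us :: "nat \<Rightarrow> 'a"
    and Cs :: "nat \<Rightarrow> 'a set"
  assumes "uniformly_smooth_space TYPE('a)"
    and "uniformly_convex_space TYPE('a)"
    and "admissible_generator g"
    and "C \<subseteq> interior (edom g)" and "C \<noteq> {}" and "closed C" and "convex C"
    and "\<forall>l\<ge>1. equilibrium_bifunction C (\<Theta> l)"
    and "\<forall>k\<ge>1. continuous_on C (A k) \<and> monotone_map_on C (A k)"
    and "\<forall>j\<ge>1. J_closed C (T j) \<and> gen_bregman_J_nonexpansive g C (T j)"
    and "\<forall>l\<ge>1. \<forall>w\<in>C. \<forall>\<rho>>0. EP_resolvent_set g C (\<Theta> l) \<rho> w \<noteq> {}"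
    and "\<forall>k\<ge>1. \<forall>w\<in>C. \<forall>\<rho>>0. VI_resolvent_set g C (A k) \<rho> w \<noteq> {}"
    and S_eq: "S = (\<Inter>j\<in>{1..}. FixJ C (T j)) \<inter> (\<Inter>l\<in>{1..}. EP C (\<Theta> l)) \<inter> (\<Inter>k\<in>{1..}. VI C (A k))"
    and "S \<noteq> {}"
    and "\<alpha>1 \<in> {0<..<1}" and "\<alpha>2 \<in> {0<..<1}" and "\<alpha>3 \<in> {0<..<1}"
    and "\<alpha>1 + \<alpha>2 + \<alpha>3 = 1"
    and "r0 > 0" and "\<forall>n\<ge>1. r n \<ge> r0"
    and "index_control \<tau>T" and "index_control \<tau>A" and "index_control \<tau>\<Theta>"
    and "x \<in> C"
    and "xs 1 = x" and "Cs 1 = C"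
    and "\<forall>n\<ge>1. zs n = EP_resolvent g C (\<Theta> (\<tau>\<Theta> n)) (r n) (xs n)"
    and "\<forall>n\<ge>1. us n = VI_resolvent g C (A (\<tau>A n)) (r n) (xs n)"
    and "\<forall>n\<ge>1. ys n = conj_gradient g
           (\<alpha>1 *\<^sub>R gradient g (xs n) + \<alpha>2 *\<^sub>R gradient g (zs n)
             + \<alpha>3 *\<^sub>R gradient g (duality_map_inv (T (\<tau>T n) (us n))))"
    and "\<forall>n\<ge>1. Cs (Suc n) = {z \<in> Cs n. bregman g z (ys n) \<le> bregman g z (xs n)}"
    and "\<forall>n\<ge>1. xs (Suc n) = bregman_projection g (Cs (Suc n)) x"
  shows "xs \<longlonglongrightarrow> bregman_projection g S x"
proof -
  note usm = assms(1) and ucv = assms(2) and ag = assms(3)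
    and C = assms(4-7) and \<Theta> = assms(8) and A = assms(9) and T = assms(10)
    and EPne = assms(11) and VIne = assms(12) and S_ne = assms(14)
    and \<alpha> = assms(15-18) and r = assms(19,20) and \<tau> = assms(21-23) and x = assms(24)
    and xs1 = assms(25) and Cs1 = assms(26) and zs = assms(27) and us = assms(28)
    and ys = assms(29) and Cs_Suc = assms(30) and xs_Suc = assms(31)
  have "interior (edom g) \<noteq> {}" using C by blast
  then obtain f where g: "g = (\<lambda>x. ereal (f x))"
    and loc: "coercive_totally_convex f (gradient g)"
    using admissible_generator_real[OF ag] by metis
  interpret coercive_totally_convex f "gradient g" by (rule loc)
  have br: "bregman g = D" by (auto simp: bregman_def D_def fun_eq_iff) (simp_all add: g)
  have proj: "bregman_projection g K x = p"
    if K: "convex K" "p \<in> K" "\<And>z. z \<in> K \<Longrightarrow> D p x \<le> D z x" for K p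
    unfolding bregman_projection_def br is_arg_min_def
    using K projection_unique[OF K(1,2)] by (intro the_equality) (auto simp: not_less)

  \<comment> \<open>Resolvents along the iteration and one-step estimates\<close>
  define \<Phi> where "\<Phi> k = (\<lambda>x y. blinfun_apply (A k x) (y - x))" for k
  have \<Phi>: "equilibrium_bifunction C (\<Phi> k)" if "k \<ge> 1" for k
    unfolding \<Phi>_def using A that C by (intro equilibrium_bifunction_monotone_map) auto
  \<comment> \<open>\<open>the_elem\<close> is meaningful only on a singleton, which
    \<open>resolvent_unique\<close> provides.\<close>
  have resolvent: "EP_resolvent g C \<Xi> \<rho> w \<in> EP_resolvent_set g C \<Xi> \<rho> w"
    if \<Xi>: "equilibrium_bifunction C \<Xi>" "\<rho> > 0" "EP_resolvent_set g C \<Xi> \<rho> w \<noteq> {}" for \<Xi> \<rho> w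
  proof -
    obtain z where z: "z \<in> EP_resolvent_set g C \<Xi> \<rho> w" using \<Xi>(3) by blast
    have "EP_resolvent_set g C \<Xi> \<rho> w = {z}"
      using z resolvent_unique[OF \<Xi>(1,2), of _ w z] unfolding EP_resolvent_set_def by blast
    then show ?thesis by (simp add: EP_resolvent_def)
  qed
  have rpos: "r n > 0" if "n \<ge> 1" for n using r that by force
  have \<tau>1: "\<tau>T n \<ge> 1" "\<tau>A n \<ge> 1" "\<tau>\<Theta> n \<ge> 1" if "n \<ge> 1" for n
    using \<tau> that by (auto simp: index_control_def)
  define vs where "vs n = duality_map_inv (T (\<tau>T n) (us n))" for n
  have zs_res: "zs n \<in> EP_resolvent_set g C (\<Theta> (\<tau>\<Theta> n)) (r n) (xs n)" if "n \<ge> 1" "xs n \<in> C" for n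
    using resolvent[of "\<Theta> (\<tau>\<Theta> n)" "r n" "xs n"] \<Theta> EPne zs \<tau>1(3) rpos that by simp
  have us_res: "us n \<in> EP_resolvent_set g C (\<Phi> (\<tau>A n)) (r n) (xs n)" if "n \<ge> 1" "xs n \<in> C" for n
  proof -
    have "us n = EP_resolvent g C (\<Phi> (\<tau>A n)) (r n) (xs n)"
      using us that by (simp add: VI_resolvent_def EP_resolvent_def VI_resolvent_set_eq_EP \<Phi>_def)
    moreover have "EP_resolvent_set g C (\<Phi> (\<tau>A n)) (r n) (xs n) \<noteq> {}"
      using VIne \<tau>1(2) rpos that unfolding \<Phi>_def VI_resolvent_set_eq_EP by simp
    ultimately show ?thesis using resolvent[OF \<Phi> rpos] \<tau>1(2) that by simp
  qed
  have zsC: "zs n \<in> C" if "n \<ge> 1" "xs n \<in> C" for n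
    using zs_res[OF that] by (simp add: EP_resolvent_set_def)
  have usC: "us n \<in> C" if "n \<ge> 1" "xs n \<in> C" for n
    using us_res[OF that] by (simp add: EP_resolvent_set_def)
  have zs_le: "D p (zs n) + D (zs n) (xs n) \<le> D p (xs n)" if "n \<ge> 1" "xs n \<in> C" "p \<in> S" for n p
  proof (rule resolvent_D_le[where r = "r n" and C = C])
    show "p \<in> EP C (\<Theta> (\<tau>\<Theta> n))" using that \<tau>1(3)[OF that(1)] unfolding S_eq by auto
  qed (use that \<tau>1(3)[OF that(1)] \<Theta> rpos zs_res[OF that(1,2)] in \<open>auto simp: EP_resolvent_set_def\<close>)
  have us_le: "D p (us n) + D (us n) (xs n) \<le> D p (xs n)" if "n \<ge> 1" "xs n \<in> C" "p \<in> S" for n p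
  proof (rule resolvent_D_le[where r = "r n" and C = C])
    show "p \<in> EP C (\<Phi> (\<tau>A n))"
      using that \<tau>1(2)[OF that(1)] unfolding S_eq \<Phi>_def VI_eq_EP[symmetric] by auto
  qed (use that \<tau>1(2)[OF that(1)] \<Phi> rpos us_res[OF that(1,2)] in \<open>auto simp: EP_resolvent_set_def\<close>)
  have vs_le: "D p (vs n) \<le> D p (us n)" if "n \<ge> 1" "xs n \<in> C" "p \<in> S" for n p
  proof -
    have "p \<in> FixJ C (T (\<tau>T n))" using that \<tau>1(1)[OF that(1)] unfolding S_eq by auto
    then show ?thesis
      using T \<tau>1(1)[OF that(1)] usC[OF that(1,2)] unfolding gen_bregman_J_nonexpansive_def br vs_def by blast
  qed
  have vsC: "vs n \<in> C" if "n \<ge> 1" "xs n \<in> C" for n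
    using T \<tau>1(1)[OF that(1)] usC[OF that] unfolding J_closed_def vs_def by blast
  \<comment> \<open>The gap terms are kept: once \<open>D p (xs n) - D p (ys n)\<close> tends to 0
    they force the auxiliary points towards \<open>ys n\<close>.\<close>
  have comb: "D p (ys n) + (\<alpha>1 * D (ys n) (xs n) + \<alpha>2 * D (ys n) (zs n) + \<alpha>3 * D (ys n) (vs n))
      \<le> D p (xs n)" if "n \<ge> 1" "xs n \<in> C" "p \<in> S" for n p
  proof -
    have "gradient g (ys n) = \<alpha>1 *\<^sub>R gradient g (xs n) + \<alpha>2 *\<^sub>R gradient g (zs n) + \<alpha>3 *\<^sub>R gradient g (vs n)"
      using ys that(1) gradient_conj_gradient unfolding vs_def g[symmetric] by simp
    note eq = D_convex_combination[OF this \<alpha>(4), of p]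
    have "\<alpha>2 * D p (zs n) \<le> \<alpha>2 * D p (xs n)" "\<alpha>3 * D p (vs n) \<le> \<alpha>3 * D p (xs n)"
      using zs_le[OF that] us_le[OF that] vs_le[OF that] D_nonneg[of "zs n" "xs n"]
        D_nonneg[of "us n" "xs n"] \<alpha> by (auto intro!: mult_left_mono)
    then have "\<alpha>1 * D p (xs n) + \<alpha>2 * D p (zs n) + \<alpha>3 * D p (vs n) \<le> (\<alpha>1 + \<alpha>2 + \<alpha>3) * D p (xs n)"
      by (simp add: distrib_right)
    then show ?thesis using eq \<alpha>(4) by simp
  qed
  have gap_nonneg: "0 \<le> \<alpha>1 * D (ys n) (xs n)" "0 \<le> \<alpha>2 * D (ys n) (zs n)" "0 \<le> \<alpha>3 * D (ys n) (vs n)" for n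
    using \<alpha> D_nonneg by simp_all

  \<comment> \<open>Well-posedness of the iteration\<close>
  \<comment> \<open>The claims need each other: \<open>xs n \<in> C\<close> makes the resolvents
    available, the resulting estimate keeps \<open>S\<close> inside the next set, and this nonempty
    set has a projection. The base case is minimal because \<open>xs 1 = x\<close>.\<close>
  have inv: "closed (Cs n) \<and> convex (Cs n) \<and> Cs n \<subseteq> C \<and> S \<subseteq> Cs n \<and> xs n \<in> Cs n \<and>
      (\<forall>z\<in>Cs n. D (xs n) x \<le> D z x)" if "n \<ge> 1" for n
    using that
  proof (induction n rule: dec_induct)
    case base
    show ?case using C Cs1 xs1 x D_nonneg unfolding S_eq by (auto simp: FixJ_def)
  next
    case (step n)
    have eq: "Cs (Suc n) = {z \<in> Cs n. D z (ys n) \<le> D z (xs n)}" using Cs_Suc step br by simp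
    have cl: "closed (Cs (Suc n))" "convex (Cs (Suc n))"
      unfolding eq using step by (auto intro: halfspace_D)
    have xC: "xs n \<in> C" using step by blast
    have "D p (ys n) \<le> D p (xs n)" if "p \<in> S" for p
      using comb[OF step(1) xC that] gap_nonneg[of n] by linarith
    then have S: "S \<subseteq> Cs (Suc n)" unfolding eq using step by blast
    then have "Cs (Suc n) \<noteq> {}" using S_ne by blast
    then obtain p where p: "p \<in> Cs (Suc n)" "\<And>z. z \<in> Cs (Suc n) \<Longrightarrow> D p x \<le> D z x"
      using projection_exists[OF cl] by metis
    have "xs (Suc n) = p" using xs_Suc step(1) proj[OF cl(2) p] by simp
    then show ?case using cl S p step eq by blast
  qed
  have xsC: "xs n \<in> C" if "n \<ge> 1" for n using inv[OF that] by blast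

  \<comment> \<open>Convergence of all sequences to one limit\<close>
  obtain p where p: "p \<in> S" using S_ne by blast
  \<comment> \<open>The iteration starts at index 1 and nothing is known at index 0, so limits are
    taken along \<open>Suc n\<close>.\<close>
  have invS: "closed (Cs (Suc n))" "convex (Cs (Suc n))" "Cs (Suc n) \<subseteq> C" "S \<subseteq> Cs (Suc n)"
    "xs (Suc n) \<in> Cs (Suc n)" "z \<in> Cs (Suc n) \<Longrightarrow> D (xs (Suc n)) x \<le> D z x" for n z
    using inv[of "Suc n"] by auto
  obtain q where q: "(\<lambda>n. xs (Suc n)) \<longlonglongrightarrow> q" "\<And>n. q \<in> Cs (Suc n)"
    "\<And>z. (\<And>n. z \<in> Cs (Suc n)) \<Longrightarrow> D q x \<le> D z x"
  proof (rule shrinking_projections[of "\<lambda>n. Cs (Suc n)" "\<lambda>n. xs (Suc n)" x p])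
    show "Cs (Suc (Suc n)) \<subseteq> Cs (Suc n)" for n using Cs_Suc by auto
  qed (use invS p in blast)+
  have qC: "q \<in> C" using q(2) invS(3) by blast
  have xq: "xs \<longlonglongrightarrow> q" using q(1) by (rule LIMSEQ_imp_Suc)
  \<comment> \<open>As \<open>q\<close> lies in every later set, the defining inequality of that set
    gives \<open>D q (ys (Suc n)) \<le> D q (xs (Suc n))\<close>, which tends to
    \<open>D q q = 0\<close>.\<close>
  have yq: "(\<lambda>n. ys (Suc n)) \<longlonglongrightarrow> q"
  proof -
    have lim: "(\<lambda>n. D q (xs (Suc n))) \<longlonglongrightarrow> 0"
      using tendsto_D[OF tendsto_const q(1), of q] by simp
    have le: "D q (ys (Suc n)) \<le> D q (xs (Suc n))" for n
      using q(2)[of "Suc n"] Cs_Suc br by simp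
    have "(\<lambda>n. D q (ys (Suc n))) \<longlonglongrightarrow> 0"
      by (rule tendsto_sandwich[OF _ _ tendsto_const lim]) (use le D_nonneg in auto)
    moreover obtain M where "\<And>n. D q (xs (Suc n)) \<le> M"
      using convergent_imp_bounded[OF lim] by (auto simp: bounded_iff abs_le_iff)
    then have "bounded (range (\<lambda>n. ys (Suc n)))"
      using le by (intro bounded_subset[OF D_right_level_bounded[of q M]]) (auto intro: order_trans)
    ultimately have "(\<lambda>n. q - ys (Suc n)) \<longlonglongrightarrow> 0" by (intro D_tendsto_0) auto
    then show ?thesis using tendsto_diff[OF tendsto_const[of q]] by fastforce
  qed
  have gap: "(\<lambda>n. D p (xs (Suc n)) - D p (ys (Suc n))) \<longlonglongrightarrow> 0"
    using tendsto_diff[OF tendsto_D[OF tendsto_const q(1)] tendsto_D[OF tendsto_const yq], of p p] by simp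
  obtain M where M: "\<And>n. D p (xs (Suc n)) \<le> M"
    using convergent_imp_bounded[OF tendsto_D[OF tendsto_const q(1), of p]]
    by (auto simp: bounded_iff abs_le_iff)
  \<comment> \<open>Shared by \<open>zs\<close> and \<open>vs\<close>: a weighted gap below
    \<open>gap\<close> tends to 0, and boundedness from the level sets at \<open>p\<close> lets
    total convexity act.\<close>
  have close: "w \<longlonglongrightarrow> q"
    if \<beta>: "\<beta> > 0" and le: "\<And>n. \<beta> * D (ys (Suc n)) (w n) \<le> D p (xs (Suc n)) - D p (ys (Suc n))"
      and le': "\<And>n. D p (w n) \<le> D p (xs (Suc n))" for w and \<beta> :: real
  proof -
    have "(\<lambda>n. \<beta> * D (ys (Suc n)) (w n)) \<longlonglongrightarrow> 0"
      by (rule tendsto_sandwich[OF _ _ tendsto_const gap]) (use \<beta> le D_nonneg in auto)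
    then have "(\<lambda>n. D (ys (Suc n)) (w n)) \<longlonglongrightarrow> 0"
      using tendsto_mult_left[of _ 0 sequentially "1 / \<beta>"] \<beta> by fastforce
    moreover have "bounded (range w)"
      using le' M by (intro bounded_subset[OF D_right_level_bounded[of p M]]) (auto intro: order_trans)
    ultimately have "(\<lambda>n. ys (Suc n) - w n) \<longlonglongrightarrow> 0"
      using convergent_imp_bounded[OF yq] by (intro D_tendsto_0) auto
    then show ?thesis using tendsto_diff[OF yq] by fastforce
  qed
  have c: "D p (ys (Suc n)) + (\<alpha>1 * D (ys (Suc n)) (xs (Suc n)) + \<alpha>2 * D (ys (Suc n)) (zs (Suc n))
      + \<alpha>3 * D (ys (Suc n)) (vs (Suc n))) \<le> D p (xs (Suc n))" for n
    by (rule comb) (use p xsC in auto)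
  have zle: "D p (zs (Suc n)) + D (zs (Suc n)) (xs (Suc n)) \<le> D p (xs (Suc n))" for n
    by (rule zs_le) (use p xsC in auto)
  have ule: "D p (us (Suc n)) + D (us (Suc n)) (xs (Suc n)) \<le> D p (xs (Suc n))" for n
    by (rule us_le) (use p xsC in auto)
  have vle: "D p (vs (Suc n)) \<le> D p (us (Suc n))" for n
    by (rule vs_le) (use p xsC in auto)
  have zq: "(\<lambda>n. zs (Suc n)) \<longlonglongrightarrow> q"
  proof (rule close[of \<alpha>2])
    show "\<alpha>2 * D (ys (Suc n)) (zs (Suc n)) \<le> D p (xs (Suc n)) - D p (ys (Suc n))" for n
      using c[of n] gap_nonneg[of "Suc n"] by linarith
    show "D p (zs (Suc n)) \<le> D p (xs (Suc n))" for n
      using zle[of n] D_nonneg[of "zs (Suc n)" "xs (Suc n)"] by linarith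
  qed (use \<alpha> in auto)
  have vq: "(\<lambda>n. vs (Suc n)) \<longlonglongrightarrow> q"
  proof (rule close[of \<alpha>3])
    show "\<alpha>3 * D (ys (Suc n)) (vs (Suc n)) \<le> D p (xs (Suc n)) - D p (ys (Suc n))" for n
      using c[of n] gap_nonneg[of "Suc n"] by linarith
    show "D p (vs (Suc n)) \<le> D p (xs (Suc n))" for n
      using vle[of n] ule[of n] D_nonneg[of "us (Suc n)" "xs (Suc n)"] by linarith
  qed (use \<alpha> in auto)
  \<comment> \<open>\<open>us\<close> does not occur directly in the convex combination; its
    distance to \<open>xs\<close> is instead squeezed by the loss from
    \<open>D p (xs (Suc n))\<close> to \<open>D p (vs (Suc n))\<close>, both of which tend to
    \<open>D p q\<close>.\<close>
  have uq: "(\<lambda>n. us (Suc n)) \<longlonglongrightarrow> q"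
  proof -
    have lim: "(\<lambda>n. D p (xs (Suc n)) - D p (vs (Suc n))) \<longlonglongrightarrow> 0"
      using tendsto_diff[OF tendsto_D[OF tendsto_const q(1)] tendsto_D[OF tendsto_const vq], of p p] by simp
    have le: "D (us (Suc n)) (xs (Suc n)) \<le> D p (xs (Suc n)) - D p (vs (Suc n))" for n
      using ule[of n] vle[of n] by linarith
    have "(\<lambda>n. D (us (Suc n)) (xs (Suc n))) \<longlonglongrightarrow> 0"
      by (rule tendsto_sandwich[OF _ _ tendsto_const lim]) (use le D_nonneg in auto)
    moreover have "D p (us (Suc n)) \<le> M" for n
      using ule[of n] M[of n] D_nonneg[of "us (Suc n)" "xs (Suc n)"] by linarith
    then have "bounded (range (\<lambda>n. us (Suc n)))"
      by (intro bounded_subset[OF D_right_level_bounded[of p M]]) auto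
    ultimately have "(\<lambda>n. us (Suc n) - xs (Suc n)) \<longlonglongrightarrow> 0"
      using convergent_imp_bounded[OF q(1)] by (intro D_tendsto_0) auto
    then show ?thesis using tendsto_add[OF _ q(1)] by fastforce
  qed

  \<comment> \<open>The limit solves every problem of the three families\<close>
  have subsequence: "\<exists>\<phi> :: nat \<Rightarrow> nat. strict_mono \<phi> \<and> (\<forall>n. \<tau> (Suc (\<phi> n)) = m)" if "index_control \<tau>" "m \<ge> 1" for \<tau> m
  proof -
    have "infinite {n. n \<ge> 1 \<and> \<tau> n = m}" using that by (simp add: index_control_def)
    moreover have "{n. n \<ge> 1 \<and> \<tau> n = m} \<subseteq> Suc ` {n. \<tau> (Suc n) = m}"
    proof
      fix n assume "n \<in> {n. n \<ge> 1 \<and> \<tau> n = m}"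
      then show "n \<in> Suc ` {n. \<tau> (Suc n) = m}" by (cases n) auto
    qed
    ultimately have "infinite {n. \<tau> (Suc n) = m}" by (meson finite_imageI finite_subset)
    then obtain \<phi> :: "nat \<Rightarrow> nat" where "strict_mono \<phi>" "\<And>n. \<phi> n \<in> {n. \<tau> (Suc n) = m}"
      using infinite_enumerate by blast
    then show ?thesis by auto
  qed
  \<comment> \<open>Where \<open>\<tau>T\<close> equals \<open>j\<close>, both \<open>us\<close> and
    its image \<open>vs\<close> tend to \<open>q\<close>, so closedness gives
    \<open>q = duality_map_inv (T j q)\<close>; applying \<open>J\<close> yields the fixed point
    equation.\<close>
  have "q \<in> FixJ C (T j)" if j: "j \<ge> 1" for j
  proof -
    obtain \<phi> :: "nat \<Rightarrow> nat" where \<phi>: "strict_mono \<phi>" "\<And>n. \<tau>T (Suc (\<phi> n)) = j" using subsequence[OF \<tau>(1) j] by blast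
    have "(\<lambda>n. us (Suc (\<phi> n))) \<longlonglongrightarrow> q" using LIMSEQ_subseq_LIMSEQ[OF uq \<phi>(1)] by (simp add: o_def)
    moreover have "(\<lambda>n. duality_map_inv (T j (us (Suc (\<phi> n))))) \<longlonglongrightarrow> q"
      using LIMSEQ_subseq_LIMSEQ[OF vq \<phi>(1)] by (simp add: o_def vs_def \<phi>(2))
    moreover have "\<forall>n. us (Suc (\<phi> n)) \<in> C" using usC xsC by simp
    moreover have "J_closed C (T j)" using T j by blast
    then have "\<And>xs y. \<forall>n::nat. xs n \<in> C \<Longrightarrow> xs \<longlonglongrightarrow> q \<Longrightarrow>
        (\<lambda>n. duality_map_inv (T j (xs n))) \<longlonglongrightarrow> y \<Longrightarrow> y = duality_map_inv (T j q)"
      using qC unfolding J_closed_def by blast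
    ultimately have "q = duality_map_inv (T j q)" by metis
    then show ?thesis using duality_map_inv_right[OF usm ucv, of "T j q"] qC by (simp add: FixJ_def)
  qed
  moreover have "q \<in> EP C (\<Theta> l)" if l: "l \<ge> 1" for l
  proof -
    obtain \<phi> :: "nat \<Rightarrow> nat" where \<phi>: "strict_mono \<phi>" "\<And>n. \<tau>\<Theta> (Suc (\<phi> n)) = l" using subsequence[OF \<tau>(3) l] by blast
    have mem: "zs (Suc (\<phi> n)) \<in> EP_resolvent_set g C (\<Theta> l) (r (Suc (\<phi> n))) (xs (Suc (\<phi> n)))" for n
      using zs_res[of "Suc (\<phi> n)"] xsC by (simp add: \<phi>(2))
    show ?thesis
    proof (rule resolvent_limit_EP)
      show "(\<lambda>n. zs (Suc (\<phi> n))) \<longlonglongrightarrow> q" using LIMSEQ_subseq_LIMSEQ[OF zq \<phi>(1)] by (simp add: o_def)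
      show "(\<lambda>n. xs (Suc (\<phi> n))) \<longlonglongrightarrow> q" using LIMSEQ_subseq_LIMSEQ[OF q(1) \<phi>(1)] by (simp add: o_def)
      show "r0 \<le> r (Suc (\<phi> n))" for n using r by simp
    qed (use mem \<Theta> l C r qC in \<open>auto simp: EP_resolvent_set_def\<close>)
  qed
  moreover have "q \<in> VI C (A k)" if k: "k \<ge> 1" for k
  proof -
    obtain \<phi> :: "nat \<Rightarrow> nat" where \<phi>: "strict_mono \<phi>" "\<And>n. \<tau>A (Suc (\<phi> n)) = k" using subsequence[OF \<tau>(2) k] by blast
    have mem: "us (Suc (\<phi> n)) \<in> EP_resolvent_set g C (\<Phi> k) (r (Suc (\<phi> n))) (xs (Suc (\<phi> n)))" for n
      using us_res[of "Suc (\<phi> n)"] xsC by (simp add: \<phi>(2))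
    have "q \<in> EP C (\<Phi> k)"
    proof (rule resolvent_limit_EP)
      show "(\<lambda>n. us (Suc (\<phi> n))) \<longlonglongrightarrow> q" using LIMSEQ_subseq_LIMSEQ[OF uq \<phi>(1)] by (simp add: o_def)
      show "(\<lambda>n. xs (Suc (\<phi> n))) \<longlonglongrightarrow> q" using LIMSEQ_subseq_LIMSEQ[OF q(1) \<phi>(1)] by (simp add: o_def)
      show "r0 \<le> r (Suc (\<phi> n))" for n using r by simp
    qed (use mem \<Phi> k C r qC in \<open>auto simp: EP_resolvent_set_def\<close>)
    then show ?thesis by (simp add: VI_eq_EP \<Phi>_def)
  qed
  ultimately have qS: "q \<in> S" unfolding S_eq by simp
  \<comment> \<open>Uniqueness of the minimizer over \<open>S\<close> is inherited from the convex set of all points lying in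
    every \<open>Cs n\<close>.\<close>
  have SCs: "z \<in> Cs (Suc n)" if "z \<in> S" for z n using invS(4) that by blast
  have cvx: "convex (\<Inter>n. Cs (Suc n))" using invS(2) by (intro convex_INT)
  have "bregman_projection g S x = q"
    unfolding bregman_projection_def br is_arg_min_def
  proof (rule the_equality)
    show "q \<in> S \<and> \<not> (\<exists>y. y \<in> S \<and> D y x < D q x)" using qS q(3) SCs by (meson not_less)
    fix w assume w: "w \<in> S \<and> \<not> (\<exists>y. y \<in> S \<and> D y x < D w x)"
    show "w = q"
      by (rule projection_unique[OF cvx]) (use w qS q SCs in \<open>auto simp: not_less\<close>)
  qed
  then show ?thesis using xq by simp
qed

end
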